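(* Let $(M,J,g)$ be a Kähler-Einstein manifold of complex dimension $4$ with non-zero scalar curvature. Then any connected minimal Cayley submanifold $N\subset M$ (i.e. a connected oriented minimal submanifold of real dimension $4$ with $\omega|_N=*_N\,\omega|_N$) is either a complex submanifold or a (minimal) Lagrangian submanifold.
   Context: $\omega(X,Y)=g(JX,Y)$ is the Kähler form of $(M,J,g)$. For an oriented submanifold $N\subset M$ of real dimension $4$, $*_N$ is the Hodge operator of the induced metric $g|_N$ and orientation; $N$ is called a Cayley submanifold if $\omega|_N=*_N\,\omega|_N$ on $N$. Kähler-Einstein means that the Ricci form is a constant multiple of $\omega$. Minimal means vanishing mean curvature vector; complex means $J(T_xN)=T_xN$ for all $x\in N$; Lagrangian means $\omega|_N=0$. *)

theory Defs
  imports "HOL-Analysis.Analysis"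
begin

section \<open>Smooth maps between Euclidean spaces\<close>

abbreviation dd :: "('e::real_normed_vector \<Rightarrow> 'f::real_normed_vector) \<Rightarrow> 'e \<Rightarrow> 'e \<Rightarrow> 'f"
  where "dd f x \<equiv> frechet_derivative f (at x)"

text \<open>Only used on open sets of finite-dimensional spaces, where it is the usual \<open>C\<^sup>k\<close>.\<close>

fun Ck_on :: "nat \<Rightarrow> 'e set \<Rightarrow> ('e::euclidean_space \<Rightarrow> 'f::real_normed_vector) \<Rightarrow> bool"
where
  "Ck_on 0 S f \<longleftrightarrow> continuous_on S f"
| "Ck_on (Suc k) S f \<longleftrightarrow> (\<forall>x\<in>S. f differentiable (at x)) \<and> (\<forall>v. Ck_on k S (\<lambda>x. dd f x v))"

definition smooth_map_on :: "'e set \<Rightarrow> ('e::euclidean_space \<Rightarrow> 'f::real_normed_vector) \<Rightarrow> bool"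
  where "smooth_map_on S f \<longleftrightarrow> (\<forall>k. Ck_on k S f)"


section \<open>Manifolds\<close>

text \<open>A chart is its domain together with its coordinate map; a manifold is a topology together
  with an atlas. The coordinate change is also used for charts \<open>c\<close>, \<open>d\<close> with different model
  spaces: if \<open>c\<close> is a chart of a manifold \<open>N\<close> and \<open>d\<close> a chart of a manifold \<open>M \<supseteq> N\<close>, then
  \<open>coord_change c d\<close>, on the image under \<open>c\<close> of the common domain, is the inclusion of \<open>N\<close> into
  \<open>M\<close> in these coordinates.\<close>

type_synonym ('p, 'e) chart = "'p set \<times> ('p \<Rightarrow> 'e)"

definition chart_image :: "('p, 'e) chart \<Rightarrow> 'e set"
  where "chart_image c = snd c ` fst c"

definition overlap :: "('p, 'e) chart \<Rightarrow> ('p, 'f) chart \<Rightarrow> 'e set"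
  where "overlap c d = snd c ` (fst c \<inter> fst d)"

definition coord_change :: "('p, 'e) chart \<Rightarrow> ('p, 'f) chart \<Rightarrow> 'e \<Rightarrow> 'f"
  where "coord_change c d = snd d \<circ> inv_into (fst c) (snd c)"

definition is_chart :: "'p topology \<Rightarrow> ('p, 'e::euclidean_space) chart \<Rightarrow> bool"
  where "is_chart X c \<longleftrightarrow> openin X (fst c) \<and> open (chart_image c) \<and>
    homeomorphic_map (subtopology X (fst c)) (top_of_set (chart_image c)) (snd c)"

definition smooth_manifold :: "'p topology \<Rightarrow> ('p, 'e::euclidean_space) chart set \<Rightarrow> bool"
  where "smooth_manifold X A \<longleftrightarrow>
    Hausdorff_space X \<and> second_countable X \<and>
    (\<forall>c\<in>A. is_chart X c) \<and> (\<Union>c\<in>A. fst c) = topspace X \<and>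
    (\<forall>c\<in>A. \<forall>d\<in>A. smooth_map_on (overlap c d) (coord_change c d))"

definition oriented_atlas :: "('p, real^'n) chart set \<Rightarrow> bool"
  where "oriented_atlas A \<longleftrightarrow>
    (\<forall>c\<in>A. \<forall>d\<in>A. \<forall>x\<in>overlap c d. det (matrix (dd (coord_change c d) x)) > 0)"

text \<open>The complex structure on the tangent spaces, in holomorphic coordinates.\<close>

definition J :: "complex^'n \<Rightarrow> complex^'n"
  where "J v = \<i> *s v"

text \<open>The coordinate changes are holomorphic: their real derivatives are complex linear.\<close>

definition complex_manifold :: "'p topology \<Rightarrow> ('p, complex^'n) chart set \<Rightarrow> bool"
  where "complex_manifold X A \<longleftrightarrow> smooth_manifold X A \<and>
    (\<forall>c\<in>A. \<forall>d\<in>A. \<forall>x\<in>overlap c d. \<forall>v.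
       dd (coord_change c d) x (J v) = J (dd (coord_change c d) x v))"


section \<open>Linear algebra of inner products\<close>

definition inner_form :: "('e::euclidean_space \<Rightarrow> 'e \<Rightarrow> real) \<Rightarrow> bool"
  where "inner_form b \<longleftrightarrow>
    bilinear b \<and> (\<forall>u v. b u v = b v u) \<and> (\<forall>u. u \<noteq> 0 \<longrightarrow> b u u > 0)"

text \<open>The vector dual to a linear functional.\<close>

definition sharp :: "('e::euclidean_space \<Rightarrow> 'e \<Rightarrow> real) \<Rightarrow> ('e \<Rightarrow> real) \<Rightarrow> 'e"
  where "sharp b l = (THE w. \<forall>v. b w v = l v)"

text \<open>The contraction \<open>\<Sum>\<^sub>i\<^sub>j b\<^sup>i\<^sup>j h(e\<^sub>i,e\<^sub>j)\<close> of a bilinear map \<open>h\<close>, where \<open>(b\<^sup>i\<^sup>j)\<close> is the inverse Gram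
  matrix of \<open>b\<close>: the vector \<open>\<Sum>\<^sub>j b\<^sup>i\<^sup>j e\<^sub>j\<close> is dual to the \<open>i\<close>-th coordinate functional.\<close>

definition metric_trace ::
    "('e::euclidean_space \<Rightarrow> 'e \<Rightarrow> real) \<Rightarrow> ('e \<Rightarrow> 'e \<Rightarrow> 'f::real_vector) \<Rightarrow> 'f"
  where "metric_trace b h = (\<Sum>i\<in>Basis. h i (sharp b (\<lambda>v. i \<bullet> v)))"

text \<open>The component of a vector orthogonal to the subspace \<open>T\<close>.\<close>

definition normal_part :: "('e::euclidean_space \<Rightarrow> 'e \<Rightarrow> real) \<Rightarrow> 'e set \<Rightarrow> 'e \<Rightarrow> 'e"
  where "normal_part b T w = (THE n. w - n \<in> T \<and> (\<forall>t\<in>T. b n t = 0))"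

definition two_form :: "('e::euclidean_space \<Rightarrow> 'e \<Rightarrow> real) \<Rightarrow> bool"
  where "two_form \<alpha> \<longleftrightarrow> bilinear \<alpha> \<and> (\<forall>u v. \<alpha> u v = - \<alpha> v u)"

definition wedge2 :: "('e \<Rightarrow> 'e \<Rightarrow> real) \<Rightarrow> ('e \<Rightarrow> 'e \<Rightarrow> real) \<Rightarrow> 'e \<Rightarrow> 'e \<Rightarrow> 'e \<Rightarrow> 'e \<Rightarrow> real"
  where "wedge2 \<alpha> \<beta> v1 v2 v3 v4 =
    \<alpha> v1 v2 * \<beta> v3 v4 - \<alpha> v1 v3 * \<beta> v2 v4 + \<alpha> v1 v4 * \<beta> v2 v3
    + \<alpha> v2 v3 * \<beta> v1 v4 - \<alpha> v2 v4 * \<beta> v1 v3 + \<alpha> v3 v4 * \<beta> v1 v2"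

text \<open>The inner product on 2-forms induced by \<open>b\<close>, i.e.
  \<open>1/2 \<Sum> b\<^sup>i\<^sup>j b\<^sup>k\<^sup>l \<alpha>(e\<^sub>i,e\<^sub>k) \<beta>(e\<^sub>j,e\<^sub>l)\<close>; for orthonormal \<open>e\<close>, this is \<open>\<Sum>\<^sub>i\<^sub><\<^sub>k \<alpha>(e\<^sub>i,e\<^sub>k) \<beta>(e\<^sub>i,e\<^sub>k)\<close>.\<close>

definition form_inner ::
    "('e::euclidean_space \<Rightarrow> 'e \<Rightarrow> real) \<Rightarrow> ('e \<Rightarrow> 'e \<Rightarrow> real) \<Rightarrow> ('e \<Rightarrow> 'e \<Rightarrow> real) \<Rightarrow> real"
  where "form_inner b \<alpha> \<beta> = metric_trace b (\<lambda>u v. metric_trace b (\<lambda>p q. \<alpha> u p * \<beta> v q)) / 2"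

text \<open>The volume form of \<open>b\<close> for the standard orientation of \<open>\<real>\<^sup>4\<close>.\<close>

definition vol_form ::
    "(real^4 \<Rightarrow> real^4 \<Rightarrow> real) \<Rightarrow> real^4 \<Rightarrow> real^4 \<Rightarrow> real^4 \<Rightarrow> real^4 \<Rightarrow> real"
  where "vol_form b v1 v2 v3 v4 =
    sqrt (det (\<chi> i j. b (axis i 1) (axis j 1))) * det (vector [v1, v2, v3, v4])"

text \<open>The Hodge operator on 2-forms: \<open>\<alpha> \<and> *\<beta> = \<langle>\<alpha>, \<beta>\<rangle> vol\<close> for all \<open>\<alpha>\<close>.\<close>

definition hodge_star :: "(real^4 \<Rightarrow> real^4 \<Rightarrow> real) \<Rightarrow> (real^4 \<Rightarrow> real^4 \<Rightarrow> real)
    \<Rightarrow> (real^4 \<Rightarrow> real^4 \<Rightarrow> real)"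
  where "hodge_star b \<beta> = (THE \<gamma>. two_form \<gamma> \<and>
    (\<forall>\<alpha>. two_form \<alpha> \<longrightarrow>
      (\<forall>v1 v2 v3 v4. wedge2 \<alpha> \<gamma> v1 v2 v3 v4 = form_inner b \<alpha> \<beta> * vol_form b v1 v2 v3 v4)))"


section \<open>Riemannian and Kaehler metrics in coordinates\<close>

text \<open>Covariant 2-tensor fields on an open set of a Euclidean space are functions
  \<open>h x u v\<close> of a point \<open>x\<close> and two tangent vectors \<open>u\<close>, \<open>v\<close>.\<close>

type_synonym 'e tensor2 = "'e \<Rightarrow> 'e \<Rightarrow> 'e \<Rightarrow> real"

definition pullback ::
    "('e::real_normed_vector \<Rightarrow> 'f::real_normed_vector) \<Rightarrow> 'f tensor2 \<Rightarrow> 'e tensor2"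
  where "pullback f h x u v = h (f x) (dd f x u) (dd f x v)"

text \<open>A Riemannian metric on a manifold: \<open>g c\<close> is its expression in the chart \<open>c\<close>.\<close>

definition riemannian_metric ::
    "('p, 'e::euclidean_space) chart set \<Rightarrow> (('p, 'e) chart \<Rightarrow> 'e tensor2) \<Rightarrow> bool"
  where "riemannian_metric A g \<longleftrightarrow>
    (\<forall>c\<in>A. (\<forall>x\<in>chart_image c. inner_form (g c x)) \<and>
            (\<forall>u v. smooth_map_on (chart_image c) (\<lambda>x. g c x u v))) \<and>
    (\<forall>c\<in>A. \<forall>d\<in>A. \<forall>x\<in>overlap c d. g c x = pullback (coord_change c d) (g d) x)"

text \<open>The Levi-Civita connection is \<open>\<nabla>\<^sub>u Y = D\<^sub>u Y + christoffel g x u Y\<close>.\<close>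

definition christoffel :: "'e tensor2 \<Rightarrow> 'e \<Rightarrow> 'e \<Rightarrow> 'e \<Rightarrow> 'e::euclidean_space"
  where "christoffel g x u v = sharp (g x) (\<lambda>w.
    (dd (\<lambda>y. g y v w) x u + dd (\<lambda>y. g y u w) x v - dd (\<lambda>y. g y u v) x w) / 2)"

text \<open>\<open>R(u,v)w = \<nabla>\<^sub>u \<nabla>\<^sub>v w - \<nabla>\<^sub>v \<nabla>\<^sub>u w\<close> for constant vector fields \<open>u\<close>, \<open>v\<close>, \<open>w\<close>.\<close>

definition riemann_curv :: "'e tensor2 \<Rightarrow> 'e \<Rightarrow> 'e \<Rightarrow> 'e \<Rightarrow> 'e \<Rightarrow> 'e::euclidean_space"
  where "riemann_curv g x u v w =
    dd (\<lambda>y. christoffel g y v w) x u + christoffel g x u (christoffel g x v w)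
    - dd (\<lambda>y. christoffel g y u w) x v - christoffel g x v (christoffel g x u w)"

definition ricci :: "'e::euclidean_space tensor2 \<Rightarrow> 'e tensor2"
  where "ricci g x v w = (\<Sum>i\<in>Basis. riemann_curv g x i v w \<bullet> i)"

definition scalar_curv :: "'e::euclidean_space tensor2 \<Rightarrow> 'e \<Rightarrow> real"
  where "scalar_curv g x = metric_trace (g x) (ricci g x)"

definition kaehler_form :: "(complex^'n) tensor2 \<Rightarrow> (complex^'n) tensor2"
  where "kaehler_form g x u v = g x (J u) v"

definition ricci_form :: "(complex^'n) tensor2 \<Rightarrow> (complex^'n) tensor2"
  where "ricci_form g x u v = ricci g x (J u) v"

definition closed_two_form :: "'e set \<Rightarrow> 'e::euclidean_space tensor2 \<Rightarrow> bool"
  where "closed_two_form S \<alpha> \<longleftrightarrow> (\<forall>x\<in>S. \<forall>u v w.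
    dd (\<lambda>y. \<alpha> y v w) x u + dd (\<lambda>y. \<alpha> y w u) x v + dd (\<lambda>y. \<alpha> y u v) x w = 0)"

definition kaehler_manifold :: "'p topology \<Rightarrow> ('p, complex^'n) chart set \<Rightarrow>
    (('p, complex^'n) chart \<Rightarrow> (complex^'n) tensor2) \<Rightarrow> bool"
  where "kaehler_manifold X A g \<longleftrightarrow> complex_manifold X A \<and> riemannian_metric A g \<and>
    (\<forall>c\<in>A. (\<forall>x\<in>chart_image c. \<forall>u v. g c x (J u) (J v) = g c x u v) \<and>
            closed_two_form (chart_image c) (kaehler_form (g c)))"

definition kaehler_einstein :: "'p topology \<Rightarrow> ('p, complex^'n) chart set \<Rightarrow>
    (('p, complex^'n) chart \<Rightarrow> (complex^'n) tensor2) \<Rightarrow> bool"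
  where "kaehler_einstein X A g \<longleftrightarrow> kaehler_manifold X A g \<and>
    (\<exists>k::real. \<forall>c\<in>A. \<forall>x\<in>chart_image c. \<forall>u v.
       ricci_form (g c) x u v = k * kaehler_form (g c) x u v)"


section \<open>Submanifolds\<close>

text \<open>A submanifold is a subset with a manifold structure of its own such that the inclusion is a
  smooth immersion. Embedded submanifolds are those where \<open>Y\<close> is the subspace topology.\<close>

definition submanifold :: "'p topology \<Rightarrow> ('p, 'f::euclidean_space) chart set \<Rightarrow>
    'p topology \<Rightarrow> ('p, 'e::euclidean_space) chart set \<Rightarrow> bool"
  where "submanifold Y B X A \<longleftrightarrow> smooth_manifold Y B \<and>
    topspace Y \<subseteq> topspace X \<and> continuous_map Y X id \<and>
    (\<forall>c\<in>B. \<forall>d\<in>A. smooth_map_on (overlap c d) (coord_change c d) \<and>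
                    (\<forall>y\<in>overlap c d. inj (dd (coord_change c d) y)))"

text \<open>In the following, \<open>f\<close> is an immersion between open sets of Euclidean spaces, and \<open>g\<close> a metric
  on the target. Its tangent space at \<open>f y\<close> is the range of \<open>dd f y\<close>, and \<open>pullback f g\<close>
  is the induced metric.\<close>

definition second_fundamental_form :: "'e tensor2 \<Rightarrow> ('f \<Rightarrow> 'e) \<Rightarrow>
    'f::euclidean_space \<Rightarrow> 'f \<Rightarrow> 'f \<Rightarrow> 'e::euclidean_space"
  where "second_fundamental_form g f y u v = normal_part (g (f y)) (range (dd f y))
    (dd (\<lambda>z. dd f z v) y u + christoffel g (f y) (dd f y u) (dd f y v))"

definition mean_curvature :: "'e tensor2 \<Rightarrow> ('f \<Rightarrow> 'e) \<Rightarrow>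
    'f::euclidean_space \<Rightarrow> 'e::euclidean_space"
  where "mean_curvature g f y =
    metric_trace (pullback f g y) (second_fundamental_form g f y) /\<^sub>R real DIM('f)"

definition minimal_submanifold :: "('p, 'f::euclidean_space) chart set \<Rightarrow>
    ('p, 'e::euclidean_space) chart set \<Rightarrow> (('p, 'e) chart \<Rightarrow> 'e tensor2) \<Rightarrow> bool"
  where "minimal_submanifold B A g \<longleftrightarrow>
    (\<forall>c\<in>B. \<forall>d\<in>A. \<forall>y\<in>overlap c d. mean_curvature (g d) (coord_change c d) y = 0)"

text \<open>The orientation of the submanifold is the one given by the charts of an oriented atlas \<open>B\<close>.\<close>

definition cayley_submanifold :: "('p, real^4) chart set \<Rightarrow> ('p, complex^'n) chart set \<Rightarrow>
    (('p, complex^'n) chart \<Rightarrow> (complex^'n) tensor2) \<Rightarrow> bool"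
  where "cayley_submanifold B A g \<longleftrightarrow> oriented_atlas B \<and>
    (\<forall>c\<in>B. \<forall>d\<in>A. \<forall>y\<in>overlap c d.
       pullback (coord_change c d) (kaehler_form (g d)) y =
       hodge_star (pullback (coord_change c d) (g d) y)
         (pullback (coord_change c d) (kaehler_form (g d)) y))"

definition complex_submanifold ::
    "('p, 'f::euclidean_space) chart set \<Rightarrow> ('p, complex^'n) chart set \<Rightarrow> bool"
  where "complex_submanifold B A \<longleftrightarrow>
    (\<forall>c\<in>B. \<forall>d\<in>A. \<forall>y\<in>overlap c d.
       J ` range (dd (coord_change c d) y) = range (dd (coord_change c d) y))"

definition lagrangian_submanifold :: "('p, 'f::euclidean_space) chart set \<Rightarrow>
    ('p, complex^'n) chart set \<Rightarrow> (('p, complex^'n) chart \<Rightarrow> (complex^'n) tensor2) \<Rightarrow> bool"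
  where "lagrangian_submanifold B A g \<longleftrightarrow>
    (\<forall>c\<in>B. \<forall>d\<in>A. \<forall>y\<in>overlap c d. \<forall>u v.
       pullback (coord_change c d) (kaehler_form (g d)) y u v = 0)"

end

(* Write omega|N = G(P.,.) for the induced metric G. Self-duality gives P^2 = -cos^2(theta) for a
   function theta. Where cos(theta) < 1, N is totally real, so restricting (4,0)-forms to N trivialises
   the canonical bundle of M along N; its connection becomes a 1-form on N whose imaginary part has,
   up to a factor, the pulled back Ricci form as differential. Where moreover cos(theta) > 0, the
   closed form omega|N is almost Kaehler up to a conformal factor, hence coclosed, and with minimality
   this makes the imaginary part of the connection form vanish. So the Ricci form k omega vanishes
   along N there, which contradicts cos(theta) > 0. Thus cos(theta) takes only the values 0 (Lagrangian
   points) and 1 (complex points), and it is constant since N is connected. *)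

theory Submission
  imports Defs
begin

section \<open>Calculus\<close>

text \<open>Along \<open>N\<close>, write the covariant derivative of a coordinate vector
  \<open>e_i\<close> in direction \<open>w\<close> as \<open>df a_i + J df b_i\<close>. The
  imaginary part of the connection trace is then a multiple of the sum of
  \<open>g(II(w, e_i), J e^i)\<close>, where \<open>II\<close> is the second fundamental form and
  \<open>e^i\<close> the dual basis. The divergence of omega|N is this sum minus the pairing of the
  mean curvature with \<open>J\<close>, which is how coclosedness and minimality combine.
  Coclosedness itself is reduced to pointwise tensor algebra, so the Hodge operator is never
  differentiated. Two obstacles shape the details. \<open>P\<close> is defined by duality, and its
  derivative is avoided: \<open>angle\<close> is differentiable as a quotient of \<open>W\<close>
  wedge \<open>W\<close> by a volume, and its derivative comes from a minimum. The value of
  \<open>angle\<close> depends formally on a pair of charts, and only its zero set is compared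
  between charts; this suffices once the values are known to be 0 and 1.\<close>

lemma dd_eqI: "(f has_derivative f') (at x) \<Longrightarrow> dd f x = f'"
  by (metis frechet_derivative_at)

lemma dd_works: "f differentiable (at x) \<Longrightarrow> (f has_derivative dd f x) (at x)"
  by (simp add: frechet_derivative_works)

lemma linear_dd: "f differentiable (at x) \<Longrightarrow> linear (dd f x)"
  by (rule linear_frechet_derivative)

lemma linear_sum_Basis:
  assumes "linear f"
  shows "f x = (\<Sum>i\<in>Basis. (x \<bullet> i) *\<^sub>R f i)"
proof -
  have "f x = f (\<Sum>i\<in>Basis. (x \<bullet> i) *\<^sub>R i)"
    by (simp add: euclidean_representation)
  also have "\<dots> = (\<Sum>i\<in>Basis. (x \<bullet> i) *\<^sub>R f i)"
    using assms by (simp add: linear_sum linear_scale)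
  finally show ?thesis .
qed

lemma bilinear_sum_Basis:
  assumes "bilinear h"
  shows "h u v = (\<Sum>i\<in>Basis. \<Sum>j\<in>Basis. (u \<bullet> i) *\<^sub>R (v \<bullet> j) *\<^sub>R h i j)"
proof -
  have l: "linear (\<lambda>u. h u v)" for v using assms by (simp add: bilinear_def)
  have r: "linear (\<lambda>v. h u v)" for u using assms by (simp add: bilinear_def)
  have "h u v = (\<Sum>i\<in>Basis. (u \<bullet> i) *\<^sub>R h i v)"
    by (rule linear_sum_Basis[OF l])
  also have "\<dots> = (\<Sum>i\<in>Basis. (u \<bullet> i) *\<^sub>R (\<Sum>j\<in>Basis. (v \<bullet> j) *\<^sub>R h i j))"
    by (subst linear_sum_Basis[OF r]) simp
  finally show ?thesis by (simp add: scaleR_sum_right)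
qed

lemma dd_cong_open:
  assumes "open S" "x \<in> S" "\<And>y. y \<in> S \<Longrightarrow> f y = g y"
  shows "dd f x = dd g x"
proof -
  have "(f has_derivative D) (at x) \<longleftrightarrow> (g has_derivative D) (at x)" for D
    using has_derivative_transform_within_open[OF _ assms(1,2)] assms(3) by metis
  then show ?thesis by (simp add: frechet_derivative_def)
qed

lemma differentiable_cong_open:
  assumes "open S" "x \<in> S" "\<And>y. y \<in> S \<Longrightarrow> f y = g y" "g differentiable (at x)"
  shows "f differentiable (at x)"
  using has_derivative_transform_within_open[where f=g and g=f, OF _ assms(1,2)] assms(3,4)
  unfolding differentiable_def by metis

lemma bounded_linear_dd:
  "bounded_linear L \<Longrightarrow> f differentiable (at x) \<Longrightarrow> dd (\<lambda>y. L (f y)) x z = L (dd f x z)"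
  by (subst dd_eqI[OF bounded_linear.has_derivative[OF _ dd_works]]) auto

text \<open>Differentiability is given only for fixed arguments. So \<open>h\<close> is expanded
  over \<open>Basis\<close>, the finite sum is differentiated termwise, and the terms with
  \<open>u'\<close> and \<open>v'\<close> are reassembled by bilinearity.\<close>

lemma has_derivative_bilinear_field:
  fixes h :: "'x::real_normed_vector \<Rightarrow> 'a::euclidean_space \<Rightarrow> 'b::euclidean_space \<Rightarrow> 'c::real_normed_vector"
    and f :: "'y::real_normed_vector \<Rightarrow> 'x"
  assumes "open T" "y \<in> T" "\<And>z. z \<in> T \<Longrightarrow> bilinear (h (f z))"
    and dh: "\<And>u v. (\<lambda>x. h x u v) differentiable (at (f y))"
    and f: "(f has_derivative f') (at y)"
    and u: "(u has_derivative u') (at y)" and v: "(v has_derivative v') (at y)"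
  shows "((\<lambda>z. h (f z) (u z) (v z)) has_derivative
    (\<lambda>z. (\<Sum>i\<in>Basis. \<Sum>j\<in>Basis. (u y \<bullet> i) *\<^sub>R (v y \<bullet> j) *\<^sub>R dd (\<lambda>x. h x i j) (f y) (f' z))
        + h (f y) (u' z) (v y) + h (f y) (u y) (v' z))) (at y)"
proof -
  have comp: "((\<lambda>z. h (f z) i j) has_derivative (\<lambda>z. dd (\<lambda>x. h x i j) (f y) (f' z))) (at y)" for i j
    by (rule has_derivative_compose[OF f dd_works[OF dh]])
  have "((\<lambda>z. \<Sum>i\<in>Basis. \<Sum>j\<in>Basis. (u z \<bullet> i) *\<^sub>R (v z \<bullet> j) *\<^sub>R h (f z) i j) has_derivative
    (\<lambda>z. \<Sum>i\<in>Basis. \<Sum>j\<in>Basis. (u y \<bullet> i) *\<^sub>R ((v y \<bullet> j) *\<^sub>R dd (\<lambda>x. h x i j) (f y) (f' z)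
         + (v' z \<bullet> j) *\<^sub>R h (f y) i j)
       + (u' z \<bullet> i) *\<^sub>R (v y \<bullet> j) *\<^sub>R h (f y) i j)) (at y)"
    by (intro has_derivative_sum has_derivative_scaleR has_derivative_inner_left u v comp)
  also have "(\<lambda>z. \<Sum>i\<in>Basis. \<Sum>j\<in>Basis. (u y \<bullet> i) *\<^sub>R ((v y \<bullet> j) *\<^sub>R dd (\<lambda>x. h x i j) (f y) (f' z)
         + (v' z \<bullet> j) *\<^sub>R h (f y) i j)
       + (u' z \<bullet> i) *\<^sub>R (v y \<bullet> j) *\<^sub>R h (f y) i j) =
     (\<lambda>z. (\<Sum>i\<in>Basis. \<Sum>j\<in>Basis. (u y \<bullet> i) *\<^sub>R (v y \<bullet> j) *\<^sub>R dd (\<lambda>x. h x i j) (f y) (f' z))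
        + h (f y) (u' z) (v y) + h (f y) (u y) (v' z))"
    unfolding bilinear_sum_Basis[OF assms(3)[OF assms(2)], of "u' _"]
      bilinear_sum_Basis[OF assms(3)[OF assms(2)], of "u y" "v' _"]
    by (simp add: sum.distrib scaleR_add_right add_ac)
  finally show ?thesis
    by (rule has_derivative_transform_within_open[OF _ assms(1,2)])
      (rule bilinear_sum_Basis[OF assms(3), symmetric])
qed

lemma dd_bilinear_field:
  fixes h :: "'x::real_normed_vector \<Rightarrow> 'a::euclidean_space \<Rightarrow> 'b::euclidean_space \<Rightarrow> 'c::real_normed_vector"
  assumes S: "open S" "x \<in> S" "\<And>y. y \<in> S \<Longrightarrow> bilinear (h y)"
    and dh: "\<And>u v. (\<lambda>y. h y u v) differentiable (at x)"
  shows "dd (\<lambda>y. h y u v) x z =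
    (\<Sum>i\<in>Basis. \<Sum>j\<in>Basis. (u \<bullet> i) *\<^sub>R (v \<bullet> j) *\<^sub>R dd (\<lambda>y. h y i j) x z)"
proof -
  have z: "h x 0 v = 0" "h x u 0 = 0" for u v
    using S(2,3) by (auto simp: bilinear_lzero bilinear_rzero)
  show ?thesis
    using dd_eqI[OF has_derivative_bilinear_field[OF S(1,2), of h "\<lambda>x. x", OF S(3) dh
        has_derivative_ident has_derivative_const[of u] has_derivative_const[of v]]]
    by (simp add: z)
qed

lemma bilinear_dd:
  fixes h :: "'x::real_normed_vector \<Rightarrow> 'a::euclidean_space \<Rightarrow> 'b::euclidean_space \<Rightarrow> 'c::real_normed_vector"
  assumes S: "open S" "x \<in> S" "\<And>y. y \<in> S \<Longrightarrow> bilinear (h y)"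
    and dh: "\<And>u v. (\<lambda>y. h y u v) differentiable (at x)"
  shows "bilinear (\<lambda>u v. dd (\<lambda>y. h y u v) x z)"
proof -
  have "(\<lambda>u v. dd (\<lambda>y. h y u v) x z) =
    (\<lambda>u v. \<Sum>i\<in>Basis. \<Sum>j\<in>Basis. (u \<bullet> i) *\<^sub>R (v \<bullet> j) *\<^sub>R dd (\<lambda>y. h y i j) x z)"
    by (intro ext dd_bilinear_field[OF S dh])
  moreover have "bilinear (\<lambda>u v. \<Sum>i\<in>Basis. \<Sum>j\<in>Basis. (u \<bullet> i) *\<^sub>R (v \<bullet> j) *\<^sub>R c i j)"
    for c :: "'a \<Rightarrow> 'b \<Rightarrow> 'c"
    unfolding bilinear_def
    by (intro conjI allI linear_compose_sum ballI)
      (auto intro!: linearI simp: inner_add_left scaleR_add_left scaleR_add_right mult.left_commute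
        distrib_left distrib_right)
  ultimately show ?thesis by simp
qed

text \<open>The product rule for a tensor evaluated on vector fields along \<open>f\<close>. The
  derivatives of the induced metric, of omega|N and of the pulled back connection form all come from
  it.\<close>

lemma has_derivative_tensor:
  fixes h :: "'x::real_normed_vector \<Rightarrow> 'a::euclidean_space \<Rightarrow> 'b::euclidean_space \<Rightarrow> 'c::real_normed_vector"
    and f :: "'y::real_normed_vector \<Rightarrow> 'x"
  assumes S: "open S" "f y \<in> S" "\<And>x. x \<in> S \<Longrightarrow> bilinear (h x)"
    and dh: "\<And>u v. (\<lambda>x. h x u v) differentiable (at (f y))"
    and T: "open T" "y \<in> T" "f ` T \<subseteq> S"
    and f: "(f has_derivative f') (at y)"
    and u: "(u has_derivative u') (at y)" and v: "(v has_derivative v') (at y)"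
  shows "((\<lambda>z. h (f z) (u z) (v z)) has_derivative
    (\<lambda>z. dd (\<lambda>x. h x (u y) (v y)) (f y) (f' z)
        + h (f y) (u' z) (v y) + h (f y) (u y) (v' z))) (at y)"
proof -
  have eq: "(\<lambda>z. dd (\<lambda>x. h x (u y) (v y)) (f y) (f' z) + h (f y) (u' z) (v y) + h (f y) (u y) (v' z))
    = (\<lambda>z. (\<Sum>i\<in>Basis. \<Sum>j\<in>Basis. (u y \<bullet> i) *\<^sub>R (v y \<bullet> j) *\<^sub>R dd (\<lambda>x. h x i j) (f y) (f' z))
        + h (f y) (u' z) (v y) + h (f y) (u y) (v' z))"
    by (intro ext arg_cong2[where f="(+)"] refl dd_bilinear_field[OF S dh])
  show ?thesis
    unfolding eq by (rule has_derivative_bilinear_field[OF T(1,2) _ dh f u v])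
      (use S(3) T(3) in auto)
qed

section \<open>Symmetry of second derivatives\<close>

lemma second_difference_estimate:
  fixes f :: "'e::real_normed_vector \<Rightarrow> real"
  assumes S: "\<And>s t. 0 \<le> s \<Longrightarrow> s \<le> h \<Longrightarrow> 0 \<le> t \<Longrightarrow> t \<le> h \<Longrightarrow> f differentiable (at (x + s *\<^sub>R u + t *\<^sub>R v))"
    and h: "0 < h"
    and est: "\<And>s t. 0 \<le> s \<Longrightarrow> s \<le> h \<Longrightarrow> 0 \<le> t \<Longrightarrow> t \<le> h \<Longrightarrow>
      \<bar>dd f (x + s *\<^sub>R u + t *\<^sub>R v) u - dd f x u - L (s *\<^sub>R u + t *\<^sub>R v)\<bar> \<le> e * h"
    and L: "linear L"
  shows "\<bar>f (x + h *\<^sub>R u + h *\<^sub>R v) - f (x + h *\<^sub>R u) - f (x + h *\<^sub>R v) + f x - h * h * L v\<bar> \<le> 2 * e * h * h"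
proof -
  \<comment> \<open>The second difference of \<open>f\<close> is a first difference of
    \<open>p\<close>, so one mean value theorem along \<open>u\<close> suffices. The derivative of
    \<open>p\<close> compares \<open>f\<close> at two points, which uses \<open>est\<close> twice
    and gives the factor 2.\<close>
  define p where "p s = f (x + s *\<^sub>R u + h *\<^sub>R v) - f (x + s *\<^sub>R u + 0 *\<^sub>R v)" for s
  have d: "((\<lambda>s. f (x + s *\<^sub>R u + t *\<^sub>R v)) has_real_derivative dd f (x + s *\<^sub>R u + t *\<^sub>R v) u) (at s)"
    if "0 \<le> s" "s \<le> h" "0 \<le> t" "t \<le> h" for s t
  proof -
    have "((\<lambda>s. f (x + s *\<^sub>R u + t *\<^sub>R v)) has_derivative
        (\<lambda>r. dd f (x + s *\<^sub>R u + t *\<^sub>R v) (r *\<^sub>R u))) (at s)"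
      by (rule has_derivative_compose[where f="\<lambda>s. x + s *\<^sub>R u + t *\<^sub>R v",
            OF _ dd_works[OF S[OF that]]]) (auto intro!: derivative_eq_intros)
    then show ?thesis
      by (rule has_derivative_imp_has_field_derivative)
        (simp add: linear_scale[OF linear_dd[OF S[OF that]]])
  qed
  have dp: "(p has_real_derivative dd f (x + s *\<^sub>R u + h *\<^sub>R v) u - dd f (x + s *\<^sub>R u + 0 *\<^sub>R v) u) (at s)"
    if "0 \<le> s" "s \<le> h" for s
    unfolding p_def using that h by (intro DERIV_diff d) auto
  obtain s where s: "0 < s" "s < h"
    and ps: "p h - p 0 = (h - 0) * (dd f (x + s *\<^sub>R u + h *\<^sub>R v) u - dd f (x + s *\<^sub>R u + 0 *\<^sub>R v) u)"
    using MVT2[OF h dp] by blast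
  have "\<bar>dd f (x + s *\<^sub>R u + h *\<^sub>R v) u - dd f (x + s *\<^sub>R u + 0 *\<^sub>R v) u - L (h *\<^sub>R v)\<bar> \<le> 2 * (e * h)"
    using est[of s h] est[of s 0] s h L by (simp add: linear_add linear_scale)
  then have "\<bar>h * (dd f (x + s *\<^sub>R u + h *\<^sub>R v) u - dd f (x + s *\<^sub>R u + 0 *\<^sub>R v) u - h * L v)\<bar>
      \<le> h * (2 * (e * h))"
    unfolding abs_mult using h L by (intro mult_mono) (auto simp: linear_scale)
  moreover have "p h - p 0 = f (x + h *\<^sub>R u + h *\<^sub>R v) - f (x + h *\<^sub>R u) - f (x + h *\<^sub>R v) + f x"
    by (simp add: p_def)
  ultimately show ?thesis using ps by (simp add: algebra_simps)
qed

text \<open>Young's theorem: the second difference along \<open>u\<close> and \<open>v\<close> is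
  symmetric in them and, divided by \<open>h * h\<close>, is close to either mixed
  derivative.\<close>

lemma dd_dd_symmetric_real:
  fixes f :: "'e::real_normed_vector \<Rightarrow> real"
  assumes S: "open S" "x \<in> S" "\<And>y. y \<in> S \<Longrightarrow> f differentiable (at y)"
    and u: "(\<lambda>y. dd f y u) differentiable (at x)" and v: "(\<lambda>y. dd f y v) differentiable (at x)"
  shows "dd (\<lambda>y. dd f y u) x v = dd (\<lambda>y. dd f y v) x u"
proof -
  let ?Lu = "dd (\<lambda>y. dd f y u) x" and ?Lv = "dd (\<lambda>y. dd f y v) x"
  define C where "C = norm u + norm v + 1"
  have C: "C > 0" by (simp add: C_def add_nonneg_pos)
  have "\<bar>?Lu v - ?Lv u\<bar> \<le> 4 * e" if e: "e > 0" for e :: real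
  proof -
    have eC: "e / C > 0" using e C by simp
    obtain d0 where d0: "d0 > 0" "ball x d0 \<subseteq> S" using S openE by blast
    obtain d1 where d1: "d1 > 0"
      "\<And>y. norm (y - x) < d1 \<Longrightarrow> norm (dd f y u - dd f x u - ?Lu (y - x)) \<le> e / C * norm (y - x)"
      using dd_works[OF u] eC unfolding has_derivative_at_alt by blast
    obtain d2 where d2: "d2 > 0"
      "\<And>y. norm (y - x) < d2 \<Longrightarrow> norm (dd f y v - dd f x v - ?Lv (y - x)) \<le> e / C * norm (y - x)"
      using dd_works[OF v] eC unfolding has_derivative_at_alt by blast
    define d where "d = min d0 (min d1 d2)"
    \<comment> \<open>All points \<open>x + s u + t v\<close> with \<open>s\<close> and
      \<open>t\<close> between 0 and \<open>h\<close> lie within \<open>C * h = d / 2\<close> of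
      \<open>x\<close>, where both linearisations hold. The tolerance \<open>e / C\<close>
      compensates the same \<open>C\<close>.\<close>
    define h where "h = d / (2 * C)"
    have d: "d > 0" using d0 d1 d2 by (simp add: d_def)
    have h: "h > 0" using d C by (simp add: h_def)
    have hC: "C * h < d" using d C by (simp add: h_def)
    have n: "norm (s *\<^sub>R u + t *\<^sub>R v) \<le> C * h" if "0 \<le> s" "s \<le> h" "0 \<le> t" "t \<le> h" for s t
    proof -
      have "norm (s *\<^sub>R u + t *\<^sub>R v) \<le> s * norm u + t * norm v"
        using norm_triangle_ineq[of "s *\<^sub>R u" "t *\<^sub>R v"] that by simp
      also have "\<dots> \<le> h * norm u + h * norm v"
        using that by (intro add_mono mult_right_mono) auto
      also have "\<dots> \<le> C * h" using h by (simp add: C_def algebra_simps)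
      finally show ?thesis .
    qed
    have diff: "f differentiable (at (x + (s *\<^sub>R u + t *\<^sub>R v)))"
      if "0 \<le> s" "s \<le> h" "0 \<le> t" "t \<le> h" for s t
    proof (rule S(3))
      have "x + (s *\<^sub>R u + t *\<^sub>R v) \<in> ball x d0"
        using n[OF that] hC by (simp add: dist_norm d_def norm_minus_commute add.commute)
      then show "x + (s *\<^sub>R u + t *\<^sub>R v) \<in> S" using d0 by blast
    qed
    have eh: "e / C * norm (s *\<^sub>R u + t *\<^sub>R v) \<le> e * h" if "0 \<le> s" "s \<le> h" "0 \<le> t" "t \<le> h" for s t
      using mult_left_mono[OF n[OF that], of "e / C"] eC C by simp
    have estu: "\<bar>dd f (x + (s *\<^sub>R u + t *\<^sub>R v)) u - dd f x u - ?Lu (s *\<^sub>R u + t *\<^sub>R v)\<bar> \<le> e * h"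
      and estv: "\<bar>dd f (x + (s *\<^sub>R u + t *\<^sub>R v)) v - dd f x v - ?Lv (s *\<^sub>R u + t *\<^sub>R v)\<bar> \<le> e * h"
      if "0 \<le> s" "s \<le> h" "0 \<le> t" "t \<le> h" for s t
      using d1(2)[of "x + (s *\<^sub>R u + t *\<^sub>R v)"] d2(2)[of "x + (s *\<^sub>R u + t *\<^sub>R v)"]
        n[OF that] eh[OF that] hC by (auto simp: d_def)
    let ?D = "f (x + h *\<^sub>R u + h *\<^sub>R v) - f (x + h *\<^sub>R u) - f (x + h *\<^sub>R v) + f x"
    have 1: "\<bar>?D - h * h * ?Lu v\<bar> \<le> 2 * e * h * h"
      by (rule second_difference_estimate[OF _ h _ linear_dd[OF u]])
        (use diff estu in \<open>simp_all add: add.assoc\<close>)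
    have "\<bar>f (x + h *\<^sub>R v + h *\<^sub>R u) - f (x + h *\<^sub>R v) - f (x + h *\<^sub>R u) + f x - h * h * ?Lv u\<bar>
        \<le> 2 * e * h * h"
    proof (rule second_difference_estimate[OF _ h _ linear_dd[OF v]])
      fix s t :: real assume st: "0 \<le> s" "s \<le> h" "0 \<le> t" "t \<le> h"
      have eq: "x + s *\<^sub>R v + t *\<^sub>R u = x + (t *\<^sub>R u + s *\<^sub>R v)"
        "s *\<^sub>R v + t *\<^sub>R u = t *\<^sub>R u + s *\<^sub>R v" by simp_all
      show "f differentiable (at (x + s *\<^sub>R v + t *\<^sub>R u))"
        unfolding eq(1) using diff st by blast
      show "\<bar>dd f (x + s *\<^sub>R v + t *\<^sub>R u) v - dd f x v - ?Lv (s *\<^sub>R v + t *\<^sub>R u)\<bar> \<le> e * h"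
        unfolding eq using estv st by blast
    qed
    then have 2: "\<bar>?D - h * h * ?Lv u\<bar> \<le> 2 * e * h * h" by (simp add: algebra_simps)
    have "\<bar>(h * h) * (?Lu v - ?Lv u)\<bar> \<le> (h * h) * (4 * e)"
      using 1 2 by (simp add: algebra_simps)
    then show ?thesis using h by (simp add: abs_mult)
  qed
  from this[of "e / 4" for e] have "\<bar>?Lu v - ?Lv u\<bar> \<le> e" if "e > 0" for e :: real
    using that by simp
  then show ?thesis
    using dense_ge[of 0 "\<bar>?Lu v - ?Lv u\<bar>"] by simp
qed

lemma dd_dd_symmetric:
  fixes f :: "'e::real_normed_vector \<Rightarrow> 'f::euclidean_space"
  assumes S: "open S" "x \<in> S" "\<And>y. y \<in> S \<Longrightarrow> f differentiable (at y)"
    and u: "(\<lambda>y. dd f y u) differentiable (at x)" and v: "(\<lambda>y. dd f y v) differentiable (at x)"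
  shows "dd (\<lambda>y. dd f y u) x v = dd (\<lambda>y. dd f y v) x u"
proof (rule euclidean_eqI)
  fix b :: 'f assume "b \<in> Basis"
  have bl: "bounded_linear (\<lambda>w. w \<bullet> b)" by (rule bounded_linear_inner_left)
  have c: "dd (\<lambda>y. f y \<bullet> b) y w = dd f y w \<bullet> b" if "y \<in> S" for y w
    by (rule bounded_linear_dd[OF bl S(3)[OF that]])
  have cc: "dd (\<lambda>y. dd (\<lambda>y. f y \<bullet> b) y w) x z = dd (\<lambda>y. dd f y w) x z \<bullet> b"
    if "(\<lambda>y. dd f y w) differentiable (at x)" for w z
    using dd_cong_open[OF S(1,2) c] bounded_linear_dd[OF bl that] by simp
  have cd: "(\<lambda>y. dd (\<lambda>y. f y \<bullet> b) y w) differentiable (at x)"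
    if "(\<lambda>y. dd f y w) differentiable (at x)" for w
    by (rule differentiable_cong_open[OF S(1,2) c]) (use that in \<open>auto simp: c intro: differentiable_inner\<close>)
  show "dd (\<lambda>y. dd f y u) x v \<bullet> b = dd (\<lambda>y. dd f y v) x u \<bullet> b"
    unfolding cc[OF u, symmetric] cc[OF v, symmetric]
    by (rule dd_dd_symmetric_real[OF S(1,2) _ cd[OF u] cd[OF v]])
      (auto intro: differentiable_inner S(3))
qed

section \<open>Derivatives of determinants\<close>

lemma has_derivative_det:
  fixes F :: "'e::real_normed_vector \<Rightarrow> 'a::real_normed_field^'n^'n"
  assumes "\<And>i j. ((\<lambda>y. F y $ i $ j) has_derivative (\<lambda>z. F' z $ i $ j)) (at x)"
  shows "((\<lambda>y. det (F y)) has_derivative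
    (\<lambda>z. \<Sum>k\<in>UNIV. det (\<chi> i. if i = k then F' z $ i else F x $ i))) (at x)"
proof -
  have "((\<lambda>y. \<Sum>p | p permutes (UNIV :: 'n set). of_int (sign p) * (\<Prod>i\<in>UNIV. F y $ i $ p i)) has_derivative
    (\<lambda>z. \<Sum>p | p permutes (UNIV :: 'n set). of_int (sign p) *
        (\<Sum>k\<in>UNIV. F' z $ k $ p k * (\<Prod>i\<in>UNIV - {k}. F x $ i $ p i)))) (at x)"
    by (intro has_derivative_sum has_derivative_mult_right has_derivative_prod assms)
  also have "(\<lambda>z. \<Sum>p | p permutes (UNIV :: 'n set). of_int (sign p) *
        (\<Sum>k\<in>UNIV. F' z $ k $ p k * (\<Prod>i\<in>UNIV - {k}. F x $ i $ p i))) =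
     (\<lambda>z. \<Sum>k\<in>UNIV. det (\<chi> i. if i = k then F' z $ i else F x $ i))"
  proof
    fix z
    have "F' z $ k $ p k * (\<Prod>i\<in>UNIV - {k}. F x $ i $ p i)
        = (\<Prod>i\<in>UNIV. (\<chi> i. if i = k then F' z $ i else F x $ i) $ i $ p i)" for k and p :: "'n \<Rightarrow> 'n"
      by (subst prod.remove[of UNIV k]) (auto intro!: prod.cong)
    then show "(\<Sum>p | p permutes (UNIV :: 'n set). of_int (sign p) *
        (\<Sum>k\<in>UNIV. F' z $ k $ p k * (\<Prod>i\<in>UNIV - {k}. F x $ i $ p i))) =
      (\<Sum>k\<in>UNIV. det (\<chi> i. if i = k then F' z $ i else F x $ i))"
      by (simp only: det_def sum_distrib_left) (rule sum.swap)
  qed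
  finally show ?thesis by (simp add: det_def)
qed

text \<open>All coefficients except \<open>c k\<close> repeat a row. Together with
  \<open>has_derivative_det\<close> this is Jacobi's formula: if the derivatives of the rows are
  combinations of the rows, the determinant is multiplied by the trace of the coefficients.\<close>

lemma det_replace_row:
  fixes A :: "'a::comm_ring_1^'n^'n"
  assumes "r = (\<Sum>j\<in>UNIV. c j *s A $ j)"
  shows "det (\<chi> i. if i = k then r else A $ i) = c k * det A"
proof -
  have "det (\<chi> i. if i = k then r else A $ i)
      = (\<Sum>j\<in>UNIV. det (\<chi> i. if i = k then c j *s A $ j else A $ i))"
    unfolding assms by (rule det_linear_row_sum) simp
  also have "\<dots> = (\<Sum>j\<in>UNIV. c j * det (\<chi> i. if i = k then A $ j else A $ i))"
    by (simp add: det_row_mul)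
  also have "\<dots> = (\<Sum>j\<in>UNIV. if j = k then c k * det A else 0)"
  proof (rule sum.cong[OF refl])
    fix j
    show "c j * det (\<chi> i. if i = k then A $ j else A $ i) = (if j = k then c k * det A else 0)"
    proof (cases "j = k")
      case True
      have "(\<chi> i. if i = k then A $ k else A $ i) = A" by (simp add: vec_eq_iff)
      then show ?thesis using True by (simp only: if_True refl)
    next
      case False
      have "det (\<chi> i. if i = k then A $ j else A $ i) = 0"
        by (rule det_identical_rows[OF False]) (simp add: row_def False)
      then show ?thesis using False by simp
    qed
  qed
  finally show ?thesis by simp
qed

section \<open>Inner products and traces\<close>

text \<open>The dual basis of \<open>Basis\<close> with respect to \<open>b\<close>. Traces pair
  \<open>i\<close> with \<open>dual b i\<close>, so no orthonormal basis has to be chosen as the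
  metric varies.\<close>

definition dual :: "('e::euclidean_space \<Rightarrow> 'e \<Rightarrow> real) \<Rightarrow> 'e \<Rightarrow> 'e"
  where "dual b i = sharp b (\<lambda>v. i \<bullet> v)"

context
  fixes b :: "'e::euclidean_space \<Rightarrow> 'e \<Rightarrow> real"
  assumes b: "inner_form b"
begin

lemma inner_form_bilinear: "bilinear b"
  and inner_form_sym: "b u v = b v u"
  and inner_form_pos: "u \<noteq> 0 \<Longrightarrow> b u u > 0"
  using b by (auto simp: inner_form_def)

lemma inner_form_linear_left: "linear (\<lambda>u. b u v)"
  and inner_form_linear_right: "linear (\<lambda>v. b u v)"
  using inner_form_bilinear by (auto simp: bilinear_def)

lemmas inner_form_simps =
  linear_add[OF inner_form_linear_left] linear_add[OF inner_form_linear_right]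
  linear_diff[OF inner_form_linear_left] linear_diff[OF inner_form_linear_right]
  linear_neg[OF inner_form_linear_left] linear_neg[OF inner_form_linear_right]
  linear_scale[OF inner_form_linear_left] linear_scale[OF inner_form_linear_right]
  linear_0[OF inner_form_linear_left] linear_0[OF inner_form_linear_right]

lemma inner_form_zero_iff: "b u u = 0 \<longleftrightarrow> u = 0"
  using inner_form_pos[of u] by (cases "u = 0") (auto simp: inner_form_simps)

lemma inner_form_nonneg: "b u u \<ge> 0"
  using inner_form_pos[of u] inner_form_zero_iff[of u] by fastforce

lemma inner_form_eqI: "(\<And>w. b u w = b v w) \<Longrightarrow> u = v"
  using inner_form_zero_iff[of "u - v"] by (simp add: inner_form_simps)

text \<open>The source of existence for \<open>sharp\<close>: lowering the index is injective by
  definiteness, hence surjective in finite dimension.\<close>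

lemma gram_map:
  shows linear_gram_map: "linear (\<lambda>w. \<Sum>i\<in>Basis. b w i *\<^sub>R i)"
    and inj_gram_map: "inj (\<lambda>w. \<Sum>i\<in>Basis. b w i *\<^sub>R i)"
proof -
  show l: "linear (\<lambda>w. \<Sum>i\<in>Basis. b w i *\<^sub>R i)"
    by (auto intro!: linearI simp: inner_form_simps scaleR_add_left sum.distrib scaleR_sum_right)
  have "w = 0" if w: "(\<Sum>i\<in>Basis. b w i *\<^sub>R i) = 0" for w
  proof -
    have "b w i = 0" if "i \<in> Basis" for i
      using arg_cong[OF w, of "\<lambda>x. x \<bullet> i"] that by (simp add: inner_sum_left inner_Basis if_distrib cong: if_cong)
    then have "b w v = 0" for v
      using linear_sum_Basis[OF inner_form_linear_right, of w v] by simp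
    then show ?thesis using inner_form_zero_iff by blast
  qed
  then show "inj (\<lambda>w. \<Sum>i\<in>Basis. b w i *\<^sub>R i)"
    using linear_injective_0[OF l] by blast
qed

lemma inner_form_sharp:
  assumes "linear l"
  shows "b (sharp b l) v = l v"
proof -
  have "surj (\<lambda>w. \<Sum>i\<in>Basis. b w i *\<^sub>R i)"
    by (rule linear_inj_imp_surj[OF gram_map])
  from surjD[OF this, of "\<Sum>i\<in>Basis. l i *\<^sub>R i"]
  obtain w where w: "(\<Sum>i\<in>Basis. b w i *\<^sub>R i) = (\<Sum>i\<in>Basis. l i *\<^sub>R i)"
    by (elim exE) (erule sym[THEN that])
  have "b w i = l i" if "i \<in> Basis" for i
    using arg_cong[OF w, of "\<lambda>x. x \<bullet> i"] that
    by (simp add: inner_sum_left inner_Basis if_distrib cong: if_cong)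
  then have "b w v = l v" for v
    using linear_sum_Basis[OF inner_form_linear_right, of w v] linear_sum_Basis[OF assms, of v] by simp
  then have "\<forall>v. b (sharp b l) v = l v"
    unfolding sharp_def by (rule_tac theI[of _ w]) (auto intro: inner_form_eqI)
  then show ?thesis by simp
qed

lemma inner_form_sharp': "linear l \<Longrightarrow> b v (sharp b l) = l v"
  by (simp add: inner_form_sym[of v] inner_form_sharp)

lemma sharp_eqI: "(\<And>v. b w v = l v) \<Longrightarrow> sharp b l = w"
  using inner_form_eqI unfolding sharp_def by (intro the_equality) auto

lemma dual: "b (dual b i) v = i \<bullet> v" "b v (dual b i) = i \<bullet> v"
proof -
  have "linear (\<lambda>v. i \<bullet> v)" by (intro bounded_linear.linear bounded_linear_inner_right)
  then show "b (dual b i) v = i \<bullet> v" "b v (dual b i) = i \<bullet> v"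
    by (simp_all add: dual_def inner_form_sharp inner_form_sharp')
qed

lemma metric_trace_dual: "metric_trace b h = (\<Sum>i\<in>Basis. h i (dual b i))"
  by (simp add: metric_trace_def dual_def)

lemma sum_scale_dual: "(\<Sum>i\<in>Basis. b x i *\<^sub>R dual b i) = x"
proof (rule inner_form_eqI)
  fix w
  have "b (\<Sum>i\<in>Basis. b x i *\<^sub>R dual b i) w = (\<Sum>i\<in>Basis. (w \<bullet> i) *\<^sub>R b x i)"
    by (simp add: linear_sum[OF inner_form_linear_left] inner_form_simps dual inner_commute mult.commute)
  then show "b (\<Sum>i\<in>Basis. b x i *\<^sub>R dual b i) w = b x w"
    using linear_sum_Basis[OF inner_form_linear_right, of x w] by simp
qed

text \<open>The coefficients \<open>dual b i \<bullet> j\<close> form the inverse Gram matrix, which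
  is symmetric.\<close>

lemma sum_dual_swap:
  assumes h: "bilinear h"
  shows "(\<Sum>i\<in>Basis. h (dual b i) i) = (\<Sum>i\<in>Basis. h i (dual b i))"
proof -
  have l: "linear (\<lambda>u. h u v)" and r: "linear (\<lambda>v. h u v)" for u v
    using h by (auto simp: bilinear_def)
  have "(\<Sum>i\<in>Basis. h (dual b i) i) = (\<Sum>i\<in>Basis. \<Sum>j\<in>Basis. (dual b i \<bullet> j) *\<^sub>R h j i)"
    by (subst linear_sum_Basis[OF l]) simp
  also have "\<dots> = (\<Sum>j\<in>Basis. \<Sum>i\<in>Basis. (dual b i \<bullet> j) *\<^sub>R h j i)"
    by (rule sum.swap)
  also have "\<dots> = (\<Sum>j\<in>Basis. \<Sum>i\<in>Basis. (dual b j \<bullet> i) *\<^sub>R h j i)"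
    by (intro sum.cong refl) (metis dual(1) dual(2) inner_commute)
  also have "\<dots> = (\<Sum>j\<in>Basis. h j (dual b j))"
    by (subst (2) linear_sum_Basis[OF r]) simp
  finally show ?thesis .
qed

text \<open>A contraction does not depend on the basis: the vectors \<open>P i\<close> again form a
  basis, with dual basis \<open>P (dual b i)\<close> divided by \<open>c\<close>.\<close>

lemma sum_dual_conformal:
  assumes h: "bilinear h" and P: "linear P" and c: "c \<noteq> 0"
    and conf: "\<And>u v. b (P u) (P v) = c * b u v"
  shows "(\<Sum>i\<in>Basis. h (P i) (P (dual b i))) = c *\<^sub>R (\<Sum>i\<in>Basis. h i (dual b i))"
proof -
  have l: "linear (\<lambda>u. h u v)" and r: "linear (\<lambda>v. h u v)" for u v
    using h by (auto simp: bilinear_def)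
  have "inj P"
    unfolding linear_injective_0[OF P] by (metis conf c inner_form_zero_iff mult_eq_0_iff inner_form_simps(9))
  then have "surj P" by (rule linear_inj_imp_surj[OF P])
  have rep: "(\<Sum>i\<in>Basis. (P i \<bullet> j) *\<^sub>R P (dual b i)) = c *\<^sub>R dual b j" for j
  proof -
    obtain q where q: "dual b j = P q" using \<open>surj P\<close> by (metis surjD)
    have "(P i \<bullet> j) *\<^sub>R P (dual b i) = c *\<^sub>R (b q i *\<^sub>R P (dual b i))" for i
    proof -
      have "P i \<bullet> j = b (P i) (P q)" by (simp add: q[symmetric] dual inner_commute)
      then show ?thesis by (simp add: conf inner_form_sym)
    qed
    then have "(\<Sum>i\<in>Basis. (P i \<bullet> j) *\<^sub>R P (dual b i)) = c *\<^sub>R (\<Sum>i\<in>Basis. b q i *\<^sub>R P (dual b i))"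
      by (simp only: scaleR_sum_right)
    also have "(\<Sum>i\<in>Basis. b q i *\<^sub>R P (dual b i)) = P (\<Sum>i\<in>Basis. b q i *\<^sub>R dual b i)"
      by (simp add: linear_sum[OF P] linear_scale[OF P])
    also have "\<dots> = dual b j" by (simp add: sum_scale_dual q)
    finally show ?thesis .
  qed
  have "(\<Sum>i\<in>Basis. h (P i) (P (dual b i))) = (\<Sum>i\<in>Basis. \<Sum>j\<in>Basis. (P i \<bullet> j) *\<^sub>R h j (P (dual b i)))"
    by (subst linear_sum_Basis[OF l]) simp
  also have "\<dots> = (\<Sum>j\<in>Basis. \<Sum>i\<in>Basis. h j ((P i \<bullet> j) *\<^sub>R P (dual b i)))"
    by (subst sum.swap) (simp add: linear_scale[OF r])
  also have "\<dots> = (\<Sum>j\<in>Basis. h j (\<Sum>i\<in>Basis. (P i \<bullet> j) *\<^sub>R P (dual b i)))"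
    by (simp only: linear_sum[OF r])
  also have "\<dots> = (\<Sum>j\<in>Basis. c *\<^sub>R h j (dual b j))"
    by (simp only: rep linear_scale[OF r])
  finally show ?thesis by (simp add: scaleR_sum_right)
qed

text \<open>Almost Kaehler forms in dimension 4 are coclosed; here \<open>N\<close> stands for the covariant derivative
  of the 2-form \<open>b(P\<cdot>,\<cdot>)\<close>.\<close>

lemma divergence_zero:
  fixes N :: "'e \<Rightarrow> 'e \<Rightarrow> 'e \<Rightarrow> real"
  assumes dim: "DIM('e) = 4" and P: "linear P" and c: "c \<noteq> 0"
    and skew: "\<And>u v. b (P u) v = - b u (P v)" and PP: "\<And>u. P (P u) = - c *\<^sub>R u"
    and N: "\<And>x. bilinear (N x)" "\<And>y. bilinear (\<lambda>x. N x y)" "\<And>z. bilinear (\<lambda>x y. N x y z)"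
    and Nskew: "\<And>x y z. N x y z = - N x z y"
    and cyclic: "\<And>x y z. N x y z + N y z x + N z x y = 0"
    and anti: "\<And>x y. N x (P y) y = \<mu> x * b y y" and mu: "linear \<mu>"
  shows "(\<Sum>i\<in>Basis. N i (dual b i) y) = 0"
proof -
  have conf: "b (P u) (P v) = c * b u v" for u v
    using skew[of u "P v"] by (simp only: PP inner_form_simps) simp
  have l2: "linear (\<lambda>y. N x y z)" and l3: "linear (\<lambda>z. N x y z)" for x y z
    using N(1)[of x] unfolding bilinear_def by blast+
  have pol: "N x (P y) z + N x (P z) y = 2 * \<mu> x * b y z" for x y z
  proof -
    have "N x (P (y + z)) (y + z) = \<mu> x * b (y + z) (y + z)" by (rule anti)
    then have "N x (P y) z + N x (P z) y + \<mu> x * b y y + \<mu> x * b z z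
        = \<mu> x * (b y y + b z z + b y z + b z y)"
      by (simp only: linear_add[OF P] linear_add[OF l2] linear_add[OF l3] inner_form_simps anti distrib_left add_ac)
    then show ?thesis
      unfolding inner_form_sym[of z y] by (simp only: distrib_left)
  qed
  \<comment> \<open>Let \<open>delta y\<close> be the divergence in the conclusion. The three
    contractions of \<open>cyclic\<close> with \<open>P\<close> in one slot are \<open>T y\<close>,
    \<open>T y\<close> and \<open>- 4 * \<mu> y\<close>, so \<open>T = 2 * \<mu>\<close>. The
    polarised \<open>anti\<close> gives \<open>T y = 2 * \<mu> y + delta (P y)\<close>. Hence
    \<open>delta\<close> vanishes on the range of \<open>P\<close>, which is the whole space. The
    two coefficients of \<open>\<mu>\<close> agree because the dimension is 4.\<close>
  define T where "T y = (\<Sum>i\<in>Basis. N i (P (dual b i)) y)" for y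
  have T: "T y = 2 * \<mu> y + (\<Sum>i\<in>Basis. N i (dual b i) (P y))" for y
  proof -
    have "T y = (\<Sum>i\<in>Basis. 2 * \<mu> i * b (dual b i) y - N i (P y) (dual b i))"
      unfolding T_def by (intro sum.cong refl) (use pol in \<open>simp only: eq_diff_eq\<close>)
    also have "\<dots> = (\<Sum>i\<in>Basis. 2 * ((y \<bullet> i) *\<^sub>R \<mu> i) + N i (dual b i) (P y))"
    proof (intro sum.cong refl)
      fix i
      show "2 * \<mu> i * b (dual b i) y - N i (P y) (dual b i) = 2 * ((y \<bullet> i) *\<^sub>R \<mu> i) + N i (dual b i) (P y)"
        using Nskew[of i "P y" "dual b i"] by (simp add: dual inner_commute)
    qed
    also have "\<dots> = 2 * (\<Sum>i\<in>Basis. (y \<bullet> i) *\<^sub>R \<mu> i) + (\<Sum>i\<in>Basis. N i (dual b i) (P y))"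
      by (simp only: sum.distrib sum_distrib_left)
    finally show ?thesis using linear_sum_Basis[OF mu, of y] by simp
  qed
  \<comment> \<open>Replacing the basis by its image under \<open>P\<close> multiplies the
    contraction by \<open>c\<close>, and \<open>P (P i) = - c i\<close> removes \<open>P\<close>
    from the first slot; skewness of \<open>N\<close> cancels the sign.\<close>
  have T2: "(\<Sum>i\<in>Basis. N (P (dual b i)) y i) = T y" for y
  proof -
    have bil: "bilinear (\<lambda>u v. N (P u) y v)"
      using N P by (auto simp: bilinear_def intro: linear_compose[unfolded o_def])
    have "c *\<^sub>R (\<Sum>i\<in>Basis. N (P (dual b i)) y i) = c *\<^sub>R (\<Sum>i\<in>Basis. N (P i) y (dual b i))"
      using sum_dual_swap[OF bil] by simp
    also have "\<dots> = (\<Sum>i\<in>Basis. N (P (P i)) y (P (dual b i)))"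
      by (rule sum_dual_conformal[OF bil P c conf, symmetric])
    also have "\<dots> = (\<Sum>i\<in>Basis. c * N i (P (dual b i)) y)"
    proof (intro sum.cong refl)
      fix i
      have "linear (\<lambda>x. N x y (P (dual b i)))" using N(2) by (auto simp: bilinear_def)
      then have *: "N (- c *\<^sub>R i) y (P (dual b i)) = - c * N i y (P (dual b i))"
        using linear_scale[of "\<lambda>x. N x y (P (dual b i))" "- c" i] by simp
      then show "N (P (P i)) y (P (dual b i)) = c * N i (P (dual b i)) y"
        using Nskew[of i y "P (dual b i)"] unfolding PP * by simp
    qed
    finally show ?thesis using c by (simp add: T_def sum_distrib_left[symmetric])
  qed
  have T3: "(\<Sum>i\<in>Basis. N y i (P (dual b i))) = - 4 * \<mu> y" for y
  proof -
    have bil: "bilinear (\<lambda>u v. N y (P v) u)"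
      using N P by (auto simp: bilinear_def intro: linear_compose[unfolded o_def])
    have "(\<Sum>i\<in>Basis. N y (P (dual b i)) i) + (\<Sum>i\<in>Basis. N y (P i) (dual b i))
        = (\<Sum>i\<in>(Basis::'e set). 2 * \<mu> y)"
      unfolding sum.distrib[symmetric] by (intro sum.cong refl) (simp add: pol dual)
    moreover have "(\<Sum>i\<in>Basis. N y (P i) (dual b i)) = (\<Sum>i\<in>Basis. N y (P (dual b i)) i)"
      by (rule sum_dual_swap[OF bil])
    ultimately have "(\<Sum>i\<in>Basis. N y (P (dual b i)) i) = 4 * \<mu> y" by (simp add: dim)
    moreover have "(\<Sum>i\<in>Basis. N y i (P (dual b i))) = - (\<Sum>i\<in>Basis. N y (P (dual b i)) i)"
      unfolding sum_negf[symmetric] by (intro sum.cong refl Nskew)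
    ultimately show ?thesis by simp
  qed
  have TT: "T y + T y - 4 * \<mu> y = 0" for y
  proof -
    have "T y + (\<Sum>i\<in>Basis. N (P (dual b i)) y i) + (\<Sum>i\<in>Basis. N y i (P (dual b i))) = 0"
      unfolding T_def sum.distrib[symmetric] by (simp add: cyclic)
    then show ?thesis by (simp add: T2 T3)
  qed
  have dP: "(\<Sum>i\<in>Basis. N i (dual b i) (P y)) = 0" for y
    using T[of y] TT[of y] by linarith
  have "c * (\<Sum>i\<in>Basis. N i (dual b i) y) = - (\<Sum>i\<in>Basis. N i (dual b i) (P (P y)))"
    by (simp add: PP linear_neg[OF l3] linear_scale[OF l3] sum_negf sum_distrib_left)
  then show ?thesis using dP c by simp
qed

text \<open>\<open>f t\<close> is the orthogonal projection of \<open>s\<close> onto the tangent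
  space. Two candidates for the normal part differ by a tangent vector orthogonal to itself, which
  settles the uniqueness demanded by \<open>THE\<close>.\<close>

lemma normal_part_inner:
  assumes f: "linear f" "inj f"
    and G: "\<And>v. b s (f v) = b (f t) (f v)"
  shows "normal_part b (range f) s = s - f t"
  unfolding normal_part_def
proof (rule the_equality)
  show "s - (s - f t) \<in> range f \<and> (\<forall>t'\<in>range f. b (s - f t) t' = 0)"
    by (auto simp: inner_form_simps G)
  fix n assume n: "s - n \<in> range f \<and> (\<forall>t'\<in>range f. b n t' = 0)"
  then obtain r where r: "s - n = f r" by blast
  have n': "n = s - f r" using r by (simp add: algebra_simps)
  have "b (f t - f r) (f v) = 0" for v
    using n G[of v] unfolding n' by (auto simp: inner_form_simps)
  then have "b (f t - f r) (f (t - r)) = 0" .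
  then have "f t - f r = 0" using inner_form_zero_iff linear_diff[OF f(1)] by metis
  then show "n = s - f t" using n' by simp
qed

end

text \<open>Beside a differentiable factor that vanishes at \<open>x\<close>, continuity of the
  other factor is enough. This is the bootstrap from continuity to differentiability in
  \<open>sharp_differentiable\<close>.\<close>

lemma differentiable_mult_zero:
  fixes p q :: "'e::real_normed_vector \<Rightarrow> real"
  assumes p: "p differentiable (at x)" "p x = 0" and q: "continuous (at x) q"
  shows "(\<lambda>y. p y * q y) differentiable (at x)"
proof -
  have "((\<lambda>y. p y * q y) has_derivative (\<lambda>z. dd p x z * q x)) (at x)"
    unfolding has_derivative_iff_norm
  proof (intro conjI)
    show "bounded_linear (\<lambda>z. dd p x z * q x)"
      using dd_works[OF p(1)] by (intro bounded_linear_mult_left[THEN bounded_linear_compose] has_derivative_bounded_linear)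
    have D: "((\<lambda>y. norm (p y - p x - dd p x (y - x)) / norm (y - x)) \<longlongrightarrow> 0) (at x)"
      using dd_works[OF p(1)] unfolding has_derivative_iff_norm by blast
    obtain K where K: "\<And>z. norm (dd p x z) \<le> norm z * K"
      using bounded_linear.bounded[OF has_derivative_bounded_linear[OF dd_works[OF p(1)]]] by blast
    have q0: "((\<lambda>y. q y - q x) \<longlongrightarrow> 0) (at x)"
      using q by (simp add: continuous_at LIM_zero)
    have "((\<lambda>y. norm (p y - p x - dd p x (y - x)) / norm (y - x) * norm (q y) + K * norm (q y - q x)) \<longlongrightarrow>
        0 * norm (q x) + K * norm (0::real)) (at x)"
      by (intro tendsto_intros D q0) (use q in \<open>simp add: continuous_at\<close>)
    then have lim: "((\<lambda>y. norm (p y - p x - dd p x (y - x)) / norm (y - x) * norm (q y) + K * norm (q y - q x)) \<longlongrightarrow> 0) (at x)"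
      by simp
    have "norm (p y * q y - p x * q x - dd p x (y - x) * q x) / norm (y - x) \<le>
        norm (p y - p x - dd p x (y - x)) / norm (y - x) * norm (q y) + K * norm (q y - q x)" if "y \<noteq> x" for y
    proof -
      have "p y * q y - p x * q x - dd p x (y - x) * q x =
          (p y - p x - dd p x (y - x)) * q y + dd p x (y - x) * (q y - q x)"
        using p(2) by (simp add: algebra_simps)
      then have "norm (p y * q y - p x * q x - dd p x (y - x) * q x) \<le>
          norm (p y - p x - dd p x (y - x)) * norm (q y) + norm (dd p x (y - x)) * norm (q y - q x)"
        by (metis norm_mult norm_triangle_ineq)
      also have "\<dots> \<le> norm (p y - p x - dd p x (y - x)) * norm (q y) + norm (y - x) * K * norm (q y - q x)"
        by (intro add_left_mono mult_right_mono K) auto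
      finally show ?thesis using that by (simp add: divide_simps mult_ac)
    qed
    then have "eventually (\<lambda>y. norm (p y * q y - p x * q x - dd p x (y - x) * q x) / norm (y - x) \<le>
        norm (p y - p x - dd p x (y - x)) / norm (y - x) * norm (q y) + K * norm (q y - q x)) (at x)"
      by (simp add: eventually_at_filter)
    then show "((\<lambda>y. norm (p y * q y - p x * q x - dd p x (y - x) * q x) / norm (y - x)) \<longlongrightarrow> 0) (at x)"
      by (rule tendsto_sandwich[OF _ _ tendsto_const lim, rotated]) (simp add: eventually_at_filter)
  qed
  then show ?thesis by (auto simp: differentiable_def)
qed

text \<open>The defining equation is frozen at \<open>x\<close> instead of inverting a varying Gram
  matrix: the constant isomorphism \<open>T\<close> applied to the unknown equals \<open>E\<close>,
  where the unknown occurs only multiplied by differences \<open>b y i j - b x i j\<close> vanishing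
  at \<open>x\<close>. Continuity of the unknown then makes \<open>E\<close> differentiable.\<close>

lemma sharp_differentiable:
  fixes b :: "'x::real_normed_vector \<Rightarrow> 'e::euclidean_space \<Rightarrow> 'e \<Rightarrow> real"
  assumes S: "open S" "x \<in> S" and b: "\<And>y. y \<in> S \<Longrightarrow> inner_form (b y)"
    and l: "\<And>y. y \<in> S \<Longrightarrow> linear (l y)"
    and db: "\<And>u v. (\<lambda>y. b y u v) differentiable (at x)"
    and dl: "\<And>v. (\<lambda>y. l y v) differentiable (at x)"
  shows "(\<lambda>y. sharp (b y) (l y)) differentiable (at x)"
proof -
  define s where "s y = sharp (b y) (l y)" for y
  define T where "T w = (\<Sum>j\<in>Basis. b x w j *\<^sub>R j)" for w
  have T: "linear T" "inj T"
    unfolding T_def using gram_map[OF b[OF S(2)]] .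
  define E where "E y = (\<Sum>j\<in>Basis. (l y j - (\<Sum>i\<in>Basis. (b y i j - b x i j) * (s y \<bullet> i))) *\<^sub>R j)" for y
  have TE: "T (s y) = E y" if y: "y \<in> S" for y
  proof -
    have "b x (s y) j = l y j - (\<Sum>i\<in>Basis. (b y i j - b x i j) * (s y \<bullet> i))" for j
    proof -
      have "l y j = b y (s y) j" by (simp add: s_def inner_form_sharp[OF b l] y)
      also have "\<dots> = (\<Sum>i\<in>Basis. (s y \<bullet> i) *\<^sub>R b y i j)"
        by (rule linear_sum_Basis[OF inner_form_linear_left[OF b[OF y]]])
      finally show ?thesis
        using linear_sum_Basis[OF inner_form_linear_left[OF b[OF S(2)]], of "s y" j]
        by (simp add: right_diff_distrib sum_subtractf mult.commute[of _ "s y \<bullet> _"])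
    qed
    then show ?thesis by (simp add: T_def E_def)
  qed
  have cont: "continuous (at x) s"
  proof -
    obtain B where B: "B > 0" "\<And>w. B * norm w \<le> norm (T w)"
      using linear_inj_bounded_below_pos[OF T] by blast
    define e where "e y = (\<Sum>j\<in>Basis. \<Sum>i\<in>Basis. \<bar>b y i j - b x i j\<bar>)" for y
    define d where "d y = (\<Sum>j\<in>Basis. \<bar>l y j - l x j\<bar>)" for y
    have lim: "((\<lambda>y. b y u v) \<longlongrightarrow> b x u v) (at x)" "((\<lambda>y. l y v) \<longlongrightarrow> l x v) (at x)" for u v
      using differentiable_imp_continuous_within[OF db] differentiable_imp_continuous_within[OF dl]
      by (auto simp: continuous_at)
    have "(e \<longlongrightarrow> (\<Sum>j\<in>(Basis::'e set). \<Sum>i\<in>(Basis::'e set). \<bar>b x i j - b x i j\<bar>)) (at x)"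
      unfolding e_def by (intro tendsto_intros lim)
    then have e: "(e \<longlongrightarrow> 0) (at x)" by simp
    have "(d \<longlongrightarrow> (\<Sum>j\<in>(Basis::'e set). \<bar>l x j - l x j\<bar>)) (at x)"
      unfolding d_def by (intro tendsto_intros lim)
    then have d: "(d \<longlongrightarrow> 0) (at x)" by simp
    have est: "B * norm (s y - s x) \<le> d y + e y * norm (s y)" if y: "y \<in> S" for y
    proof -
      have "B * norm (s y - s x) \<le> norm (E y - E x)"
        using B(2)[of "s y - s x"] by (simp add: linear_diff[OF T(1)] TE y S(2))
      also have "E y - E x = (\<Sum>j\<in>Basis. (l y j - l x j - (\<Sum>i\<in>Basis. (b y i j - b x i j) * (s y \<bullet> i))) *\<^sub>R j)"
        unfolding E_def sum_subtractf[symmetric] by (intro sum.cong refl) (simp add: algebra_simps)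
      also have "norm \<dots> \<le> (\<Sum>j\<in>Basis. \<bar>l y j - l x j - (\<Sum>i\<in>Basis. (b y i j - b x i j) * (s y \<bullet> i))\<bar>)"
        by (rule sum_norm_le) simp
      also have "\<dots> \<le> (\<Sum>j\<in>(Basis::'e set). \<bar>l y j - l x j\<bar> + (\<Sum>i\<in>(Basis::'e set). \<bar>b y i j - b x i j\<bar> * norm (s y)))"
      proof (rule sum_mono)
        fix j :: 'e
        have "\<bar>\<Sum>i\<in>Basis. (b y i j - b x i j) * (s y \<bullet> i)\<bar> \<le> (\<Sum>i\<in>Basis. \<bar>b y i j - b x i j\<bar> * norm (s y))"
          by (rule order_trans[OF sum_abs sum_mono]) (auto simp: abs_mult intro!: mult_left_mono Basis_le_norm)
        then show "\<bar>l y j - l x j - (\<Sum>i\<in>Basis. (b y i j - b x i j) * (s y \<bullet> i))\<bar> \<le>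
            \<bar>l y j - l x j\<bar> + (\<Sum>i\<in>Basis. \<bar>b y i j - b x i j\<bar> * norm (s y))"
          by linarith
      qed
      also have "\<dots> = d y + e y * norm (s y)"
        by (simp add: d_def e_def sum.distrib sum_distrib_right)
      finally show ?thesis .
    qed
    \<comment> \<open>Once \<open>e y < B / 2\<close>, the part of \<open>e y * norm (s y)\<close>
      due to \<open>s y - s x\<close> is absorbed by the left side of \<open>est\<close>.\<close>
    have "eventually (\<lambda>y. e y < B / 2) (at x)" by (rule order_tendstoD(2)[OF e]) (use B in simp)
    moreover have "eventually (\<lambda>y. y \<in> S) (at x)" by (rule eventually_at_in_open'[OF S])
    ultimately have ev: "eventually (\<lambda>y. norm (s y - s x) \<le> 2 / B * (d y + e y * norm (s x))) (at x)"
    proof eventually_elim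
      case (elim y)
      have e0: "e y \<ge> 0" unfolding e_def by (intro sum_nonneg) auto
      have "norm (s y) \<le> norm (s y - s x) + norm (s x)" by (metis diff_add_cancel norm_triangle_ineq)
      then have "e y * norm (s y) \<le> e y * norm (s y - s x) + e y * norm (s x)"
        using mult_left_mono[OF _ e0] by (simp add: distrib_left[symmetric])
      moreover have "e y * norm (s y - s x) \<le> B / 2 * norm (s y - s x)"
        using elim by (intro mult_right_mono) auto
      ultimately have "B / 2 * norm (s y - s x) \<le> d y + e y * norm (s x)"
        using est[OF elim(2)] by linarith
      then show ?case using B(1) by (simp add: field_simps)
    qed
    have "((\<lambda>y. 2 / B * (d y + e y * norm (s x))) \<longlongrightarrow> 2 / B * (0 + 0 * norm (s x))) (at x)"
      by (intro tendsto_intros d e)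
    then have "((\<lambda>y. 2 / B * (d y + e y * norm (s x))) \<longlongrightarrow> 0) (at x)" by simp
    from Lim_null_comparison[OF ev this] show ?thesis
      by (simp add: continuous_at LIM_zero_iff)
  qed
  have "E differentiable (at x)"
    unfolding E_def
  proof (intro differentiable_sum differentiable_scaleR differentiable_diff dl differentiable_const finite_Basis ballI)
    fix i j :: 'e
    show "(\<lambda>y. (b y i j - b x i j) * (s y \<bullet> i)) differentiable at x"
      by (intro differentiable_mult_zero differentiable_diff db differentiable_const continuous_inner cont continuous_const) simp
  qed
  moreover obtain T' where T': "linear T'" "T' \<circ> T = id"
    using linear_injective_left_inverse[OF T] by blast
  ultimately have "(\<lambda>y. T' (E y)) differentiable (at x)"
    using bounded_linear.has_derivative[OF linear_conv_bounded_linear[THEN iffD1, OF T'(1)] dd_works]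
    by (auto simp: differentiable_def)
  then show ?thesis
    unfolding s_def[symmetric]
    by (rule differentiable_cong_open[OF S, rotated]) (metis T'(2) TE comp_apply id_apply)
qed

text \<open>Laplace expansion along the first two rows: the products of 2x2 minors match the
  products of 2-forms in \<open>wedge2\<close>.\<close>

lemma det_4:
  fixes A :: "'a::comm_ring_1^4^4"
  shows "det A =
    (A$1$1*A$2$2 - A$1$2*A$2$1) * (A$3$3*A$4$4 - A$3$4*A$4$3)
  - (A$1$1*A$2$3 - A$1$3*A$2$1) * (A$3$2*A$4$4 - A$3$4*A$4$2)
  + (A$1$1*A$2$4 - A$1$4*A$2$1) * (A$3$2*A$4$3 - A$3$3*A$4$2)
  + (A$1$2*A$2$3 - A$1$3*A$2$2) * (A$3$1*A$4$4 - A$3$4*A$4$1)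
  - (A$1$2*A$2$4 - A$1$4*A$2$2) * (A$3$1*A$4$3 - A$3$3*A$4$1)
  + (A$1$3*A$2$4 - A$1$4*A$2$3) * (A$3$1*A$4$2 - A$3$2*A$4$1)"
proof -
  have f: "finite {2::4, 3, 4}" "1 \<notin> {2::4, 3, 4}" "finite {3::4, 4}" "2 \<notin> {3::4, 4}"
    "finite {4::4}" "3 \<notin> {4::4}" by auto
  show ?thesis
    unfolding det_def UNIV_4
    unfolding sum_over_permutations_insert[OF f(1,2)] sum_over_permutations_insert[OF f(3,4)]
      sum_over_permutations_insert[OF f(5,6)]
    unfolding permutes_sing
    by (simp add: sign_swap_id permutation_swap_id permutation_compose sign_compose sign_id swap_id_eq)
      (simp add: algebra_simps)
qed

lemma vector_4:
  "(vector [a, b, c, d] :: 'a::zero^4) $ 1 = a" "(vector [a, b, c, d] :: 'a^4) $ 2 = b"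
  "(vector [a, b, c, d] :: 'a^4) $ 3 = c" "(vector [a, b, c, d] :: 'a^4) $ 4 = d"
  unfolding vector_def by simp_all

lemma wedge2_det:
  fixes \<alpha> \<gamma> :: "real^4 \<Rightarrow> real^4 \<Rightarrow> real"
  assumes \<alpha>: "\<And>u v. \<alpha> u v = a12 * (u$1 * v$2 - u$2 * v$1) + a13 * (u$1 * v$3 - u$3 * v$1) + a14 * (u$1 * v$4 - u$4 * v$1)
      + a23 * (u$2 * v$3 - u$3 * v$2) + a24 * (u$2 * v$4 - u$4 * v$2) + a34 * (u$3 * v$4 - u$4 * v$3)"
    and \<gamma>: "\<And>u v. \<gamma> u v = c12 * (u$1 * v$2 - u$2 * v$1) + c13 * (u$1 * v$3 - u$3 * v$1) + c14 * (u$1 * v$4 - u$4 * v$1)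
      + c23 * (u$2 * v$3 - u$3 * v$2) + c24 * (u$2 * v$4 - u$4 * v$2) + c34 * (u$3 * v$4 - u$4 * v$3)"
  shows "wedge2 \<alpha> \<gamma> v1 v2 v3 v4 =
    (a12 * c34 - a13 * c24 + a14 * c23 + a23 * c14 - a24 * c13 + a34 * c12) * det (vector [v1, v2, v3, v4])"
  unfolding wedge2_def \<alpha> \<gamma> det_4 vector_4
  by algebra

section \<open>The Hodge operator in dimension 4\<close>

lemma two_form_bilinear: "two_form \<alpha> \<Longrightarrow> bilinear \<alpha>"
  and two_form_skew: "two_form \<alpha> \<Longrightarrow> \<alpha> u v = - \<alpha> v u"
  unfolding two_form_def by blast+

lemma two_form_linear:
  assumes "two_form \<alpha>"
  shows "linear (\<lambda>u. \<alpha> u v)" "linear (\<alpha> v)"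
  using two_form_bilinear[OF assms] by (auto simp: bilinear_def)

lemma two_form_coordinates:
  assumes "two_form (\<alpha> :: real^4 \<Rightarrow> real^4 \<Rightarrow> real)"
  shows "\<alpha> u v = \<alpha> (axis 1 1) (axis 2 1) * (u$1 * v$2 - u$2 * v$1) + \<alpha> (axis 1 1) (axis 3 1) * (u$1 * v$3 - u$3 * v$1)
      + \<alpha> (axis 1 1) (axis 4 1) * (u$1 * v$4 - u$4 * v$1) + \<alpha> (axis 2 1) (axis 3 1) * (u$2 * v$3 - u$3 * v$2)
      + \<alpha> (axis 2 1) (axis 4 1) * (u$2 * v$4 - u$4 * v$2) + \<alpha> (axis 3 1) (axis 4 1) * (u$3 * v$4 - u$4 * v$3)"
proof -
  have skew: "\<And>u v. \<alpha> u v = - \<alpha> v u"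
    by (rule two_form_skew[OF assms])
  have z: "\<alpha> u u = 0" for u using skew[of u u] by simp
  have l: "linear (\<lambda>u. \<alpha> u v)" and r: "linear (\<lambda>v. \<alpha> u v)" for u v
    by (rule two_form_linear[OF assms])+
  have e: "u = u$1 *\<^sub>R axis 1 1 + u$2 *\<^sub>R axis 2 1 + u$3 *\<^sub>R axis 3 1 + u$4 *\<^sub>R axis 4 1" for u :: "real^4"
    by (simp add: vec_eq_iff forall_4 axis_def)
  have "\<alpha> u v = \<alpha> (u$1 *\<^sub>R axis 1 1 + u$2 *\<^sub>R axis 2 1 + u$3 *\<^sub>R axis 3 1 + u$4 *\<^sub>R axis 4 1)
      (v$1 *\<^sub>R axis 1 1 + v$2 *\<^sub>R axis 2 1 + v$3 *\<^sub>R axis 3 1 + v$4 *\<^sub>R axis 4 1)"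
    using e[of u] e[of v] by simp
  also have "\<dots> = \<alpha> (axis 1 1) (axis 2 1) * (u$1 * v$2 - u$2 * v$1) + \<alpha> (axis 1 1) (axis 3 1) * (u$1 * v$3 - u$3 * v$1)
      + \<alpha> (axis 1 1) (axis 4 1) * (u$1 * v$4 - u$4 * v$1) + \<alpha> (axis 2 1) (axis 3 1) * (u$2 * v$3 - u$3 * v$2)
      + \<alpha> (axis 2 1) (axis 4 1) * (u$2 * v$4 - u$4 * v$2) + \<alpha> (axis 3 1) (axis 4 1) * (u$3 * v$4 - u$4 * v$3)"
    by (simp add: linear_add[OF l] linear_add[OF r] linear_scale[OF l] linear_scale[OF r] z
        skew[of "axis 2 1" "axis 1 1"] skew[of "axis 3 1" "axis 1 1"] skew[of "axis 4 1" "axis 1 1"]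
        skew[of "axis 3 1" "axis 2 1"] skew[of "axis 4 1" "axis 2 1"] skew[of "axis 4 1" "axis 3 1"]
        algebra_simps)
  finally show ?thesis .
qed

text \<open>A kernel vector of the Gram matrix is orthogonal to every basis vector, hence
  zero.\<close>

lemma gram_det_nonzero:
  fixes b :: "real^'n \<Rightarrow> real^'n \<Rightarrow> real"
  assumes b: "inner_form b"
  shows "det (\<chi> i j. b (axis i 1) (axis j 1)) \<noteq> 0"
proof -
  let ?M = "\<chi> i j. b (axis i 1) (axis j 1)"
  have "x = 0" if x: "?M *v x = 0" for x
  proof (rule inner_form_eqI[OF b])
    fix w
    have rep: "b u v = (\<Sum>j\<in>UNIV. v $ j * b u (axis j 1))" for u v
    proof -
      have "v = (\<Sum>j\<in>UNIV. v $ j *\<^sub>R axis j 1)"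
        by (simp add: vec_eq_iff axis_def if_distrib cong: if_cong)
      then have "b u v = b u (\<Sum>j\<in>UNIV. v $ j *\<^sub>R axis j 1)" by simp
      then show ?thesis
        by (simp add: linear_sum[OF inner_form_linear_right[OF b]] inner_form_simps[OF b])
    qed
    have "b (axis i 1) x = 0" for i
      using arg_cong[OF x, of "\<lambda>v. v $ i"] by (simp add: rep[of _ x] matrix_vector_mult_def mult.commute)
    then have "b x w = 0"
      using rep[of x w] by (simp add: inner_form_sym[OF b, of x])
    then show "b x w = b 0 w" by (simp add: inner_form_simps[OF b])
  qed
  then show ?thesis
    by (metis invertible_det_nz invertible_left_inverse matrix_left_invertible_ker)
qed

definition elem_form :: "4 \<Rightarrow> 4 \<Rightarrow> real^4 \<Rightarrow> real^4 \<Rightarrow> real"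
  where "elem_form k l u v = u $ k * v $ l - u $ l * v $ k"

lemma two_form_elem_form: "two_form (elem_form k l)"
  unfolding two_form_def bilinear_def elem_form_def
  by (auto intro!: linearI simp: algebra_simps)

lemma two_form_lincomb:
  assumes "two_form \<alpha>" "two_form \<beta>"
  shows "two_form (\<lambda>u v. r * \<alpha> u v + s * \<beta> u v)"
proof -
  note lin = two_form_linear[OF assms(1)] two_form_linear[OF assms(2)]
  have "r * \<alpha> u v + s * \<beta> u v = - (r * \<alpha> v u + s * \<beta> v u)" for u v
    using two_form_skew[OF assms(1), of u v] two_form_skew[OF assms(2), of u v] by simp
  moreover have "bilinear (\<lambda>u v. r * \<alpha> u v + s * \<beta> u v)"
    unfolding bilinear_def
    by (auto intro!: linearI simp: lin[THEN linear_add] lin[THEN linear_scale] algebra_simps)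
  ultimately show ?thesis unfolding two_form_def by blast
qed

lemma form_inner_lincomb:
  "form_inner b (\<lambda>u v. r * \<alpha> u v + s * \<alpha>' u v) \<beta> = r * form_inner b \<alpha> \<beta> + s * form_inner b \<alpha>' \<beta>"
  by (simp add: form_inner_def metric_trace_def algebra_simps sum.distrib sum_distrib_left add_divide_distrib)

text \<open>The nesting with factors \<open>1\<close> makes every layer an instance of
  \<open>r * \<alpha> u v + s * \<beta> u v\<close>, the pattern of \<open>two_form_lincomb\<close>
  and \<open>form_inner_lincomb\<close>.\<close>

lemma two_form_eq_elem_forms:
  fixes \<alpha> :: "real^4 \<Rightarrow> real^4 \<Rightarrow> real"
  assumes "two_form \<alpha>"
  shows "\<alpha> = (\<lambda>u v. \<alpha> (axis 1 1) (axis 2 1) * elem_form 1 2 u v + 1 * (\<alpha> (axis 1 1) (axis 3 1) * elem_form 1 3 u v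
      + 1 * (\<alpha> (axis 1 1) (axis 4 1) * elem_form 1 4 u v + 1 * (\<alpha> (axis 2 1) (axis 3 1) * elem_form 2 3 u v
      + 1 * (\<alpha> (axis 2 1) (axis 4 1) * elem_form 2 4 u v + \<alpha> (axis 3 1) (axis 4 1) * elem_form 3 4 u v)))))"
  by (intro ext, rule trans[OF two_form_coordinates[OF assms]]) (simp only: elem_form_def mult_1 add_ac)

lemma det_axes: "det (vector [axis 1 1, axis 2 1, axis 3 1, axis 4 1] :: real^4^4) = 1"
  by (simp add: det_4 vector_4 axis_def)

lemma wedge2_two_forms:
  fixes \<alpha> \<gamma> :: "real^4 \<Rightarrow> real^4 \<Rightarrow> real"
  assumes "two_form \<alpha>" "two_form \<gamma>"
  shows "wedge2 \<alpha> \<gamma> v1 v2 v3 v4 =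
    wedge2 \<alpha> \<gamma> (axis 1 1) (axis 2 1) (axis 3 1) (axis 4 1) * det (vector [v1, v2, v3, v4])"
  unfolding wedge2_det[OF two_form_coordinates[OF assms(1)] two_form_coordinates[OF assms(2)]]
  by (simp add: det_axes)

lemma hodge_star_exists:
  fixes b :: "real^4 \<Rightarrow> real^4 \<Rightarrow> real"
  assumes b: "inner_form b" and \<beta>: "two_form \<beta>"
  shows "\<exists>!\<gamma>. two_form \<gamma> \<and> (\<forall>\<alpha>. two_form \<alpha> \<longrightarrow>
      (\<forall>v1 v2 v3 v4. wedge2 \<alpha> \<gamma> v1 v2 v3 v4 = form_inner b \<alpha> \<beta> * vol_form b v1 v2 v3 v4))"
proof -
  let ?w = "\<lambda>\<alpha> \<gamma>. wedge2 \<alpha> \<gamma> (axis 1 1) (axis 2 1) (axis 3 1) (axis 4 1 :: real^4)"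
  define D where "D = sqrt (det (\<chi> i j. b (axis i 1) (axis j 1)))"
  define K where "K \<alpha> = form_inner b \<alpha> \<beta> * D" for \<alpha>
  \<comment> \<open>Wedging with \<open>elem_form k l\<close> isolates the coefficient at the
    complementary pair of indices, up to the sign of the permutation. This forces all six
    coefficients, and so gives uniqueness as well.\<close>
  define \<gamma> where "\<gamma> u v = K (elem_form 3 4) * elem_form 1 2 u v + 1 * (- K (elem_form 2 4) * elem_form 1 3 u v
      + 1 * (K (elem_form 2 3) * elem_form 1 4 u v + 1 * (K (elem_form 1 4) * elem_form 2 3 u v
      + 1 * (- K (elem_form 1 3) * elem_form 2 4 u v + K (elem_form 1 2) * elem_form 3 4 u v))))" for u v
  have \<gamma>: "two_form \<gamma>"
    unfolding \<gamma>_def[abs_def] by (intro two_form_lincomb two_form_elem_form)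
  have val: "\<gamma> (axis 1 1) (axis 2 1) = K (elem_form 3 4)" "\<gamma> (axis 1 1) (axis 3 1) = - K (elem_form 2 4)"
    "\<gamma> (axis 1 1) (axis 4 1) = K (elem_form 2 3)" "\<gamma> (axis 2 1) (axis 3 1) = K (elem_form 1 4)"
    "\<gamma> (axis 2 1) (axis 4 1) = - K (elem_form 1 3)" "\<gamma> (axis 3 1) (axis 4 1) = K (elem_form 1 2)"
    by (simp_all add: \<gamma>_def elem_form_def axis_def)
  have w: "?w \<alpha> \<gamma> = K \<alpha>" if \<alpha>: "two_form \<alpha>" for \<alpha>
  proof -
    have "K \<alpha> = \<alpha> (axis 1 1) (axis 2 1) * K (elem_form 1 2) + \<alpha> (axis 1 1) (axis 3 1) * K (elem_form 1 3)
      + \<alpha> (axis 1 1) (axis 4 1) * K (elem_form 1 4) + \<alpha> (axis 2 1) (axis 3 1) * K (elem_form 2 3)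
      + \<alpha> (axis 2 1) (axis 4 1) * K (elem_form 2 4) + \<alpha> (axis 3 1) (axis 4 1) * K (elem_form 3 4)"
      unfolding K_def
      by (subst two_form_eq_elem_forms[OF \<alpha>], simp only: form_inner_lincomb) (simp add: algebra_simps)
    then show ?thesis
      by (simp add: wedge2_def val algebra_simps)
  qed
  have vol: "vol_form b v1 v2 v3 v4 = D * det (vector [v1, v2, v3, v4])" for v1 v2 v3 v4
    by (simp add: vol_form_def D_def)
  show ?thesis
  proof (rule ex1I[of _ \<gamma>])
    show "two_form \<gamma> \<and> (\<forall>\<alpha>. two_form \<alpha> \<longrightarrow>
      (\<forall>v1 v2 v3 v4. wedge2 \<alpha> \<gamma> v1 v2 v3 v4 = form_inner b \<alpha> \<beta> * vol_form b v1 v2 v3 v4))"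
    proof (intro conjI \<gamma> allI impI)
      fix \<alpha> :: "real^4 \<Rightarrow> real^4 \<Rightarrow> real" and v1 v2 v3 v4 assume "two_form \<alpha>"
      then show "wedge2 \<alpha> \<gamma> v1 v2 v3 v4 = form_inner b \<alpha> \<beta> * vol_form b v1 v2 v3 v4"
        by (subst wedge2_two_forms) (simp_all add: \<gamma> w vol K_def)
    qed
  next
    fix \<delta> assume \<delta>: "two_form \<delta> \<and> (\<forall>\<alpha>. two_form \<alpha> \<longrightarrow>
      (\<forall>v1 v2 v3 v4. wedge2 \<alpha> \<delta> v1 v2 v3 v4 = form_inner b \<alpha> \<beta> * vol_form b v1 v2 v3 v4))"
    have wd: "?w (elem_form k l) \<delta> = K (elem_form k l)" for k l
      using \<delta> two_form_elem_form[of k l] by (simp add: vol det_axes K_def)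
    have "\<delta> (axis 1 1) (axis 2 1) = K (elem_form 3 4)" "\<delta> (axis 1 1) (axis 3 1) = - K (elem_form 2 4)"
      "\<delta> (axis 1 1) (axis 4 1) = K (elem_form 2 3)" "\<delta> (axis 2 1) (axis 3 1) = K (elem_form 1 4)"
      "\<delta> (axis 2 1) (axis 4 1) = - K (elem_form 1 3)" "\<delta> (axis 3 1) (axis 4 1) = K (elem_form 1 2)"
      unfolding wd[symmetric] by (simp_all add: wedge2_def elem_form_def axis_def)
    note this[folded val]
    then show "\<delta> = \<gamma>"
      using two_form_coordinates[OF conjunct1[OF \<delta>]] two_form_coordinates[OF \<gamma>]
      by (intro ext) metis
  qed
qed

lemma hodge_star:
  fixes b :: "real^4 \<Rightarrow> real^4 \<Rightarrow> real"
  assumes "inner_form b" "two_form \<beta>"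
  shows "two_form \<alpha> \<Longrightarrow> wedge2 \<alpha> (hodge_star b \<beta>) v1 v2 v3 v4 = form_inner b \<alpha> \<beta> * vol_form b v1 v2 v3 v4"
  using theI'[OF hodge_star_exists[OF assms]] unfolding hodge_star_def by blast

text \<open>Contraction with the dual basis turns the 1-forms \<open>l\<close> and \<open>m\<close>
  into the vectors \<open>sharp b l\<close> and \<open>sharp b m\<close>. For skew
  \<open>\<beta>\<close> the right side is just \<open>\<beta>\<close> on this pair.\<close>

lemma form_inner_decomposable:
  assumes b: "inner_form b" and \<beta>: "bilinear \<beta>" and l: "linear l" "linear m"
  shows "form_inner b (\<lambda>u v. l u * m v - m u * l v) \<beta> = (\<beta> (sharp b l) (sharp b m) - \<beta> (sharp b m) (sharp b l)) / 2"
proof -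
  have bl: "linear (\<lambda>u. \<beta> u v)" and br: "linear (\<lambda>v. \<beta> u v)" for u v
    using \<beta> by (auto simp: bilinear_def)
  have rep: "(\<Sum>i\<in>Basis. k i *\<^sub>R dual b i) = sharp b k" if "linear k" for k
    using sum_scale_dual[OF b, of "sharp b k"] by (simp add: inner_form_sharp[OF b that])
  have dbl: "(\<Sum>i\<in>Basis. \<Sum>j\<in>Basis. k i * n j * \<beta> (dual b i) (dual b j)) = \<beta> (sharp b k) (sharp b n)"
    if "linear k" "linear n" for k n
    unfolding rep[OF that(1), symmetric] rep[OF that(2), symmetric]
    by (simp add: linear_sum[OF bl] linear_sum[OF br] linear_scale[OF bl] linear_scale[OF br]
        sum_distrib_left mult_ac) (rule sum.swap)
  have "form_inner b (\<lambda>u v. l u * m v - m u * l v) \<beta> =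
    ((\<Sum>i\<in>Basis. \<Sum>j\<in>Basis. l i * m j * \<beta> (dual b i) (dual b j)) -
     (\<Sum>i\<in>Basis. \<Sum>j\<in>Basis. m i * l j * \<beta> (dual b i) (dual b j))) / 2"
    by (simp add: form_inner_def metric_trace_dual[OF b] sum_subtractf[symmetric] left_diff_distrib)
  then show ?thesis using dbl[OF l] dbl[OF l(2,1)] by simp
qed

text \<open>With \<open>\<alpha> = u\<^sup>\<flat> \<and> \<iota>\<^sub>u\<beta>\<close>, the two sides of \<open>\<alpha> \<and> \<beta> = \<langle>\<alpha>, \<beta>\<rangle> vol\<close> contain \<open>\<bar>\<iota>\<^sub>u\<beta>\<bar>\<^sup>2\<close> and
  \<open>u\<^sup>\<flat> \<and> \<iota>\<^sub>u(\<beta> \<and> \<beta>) / 2 = \<bar>\<beta>\<bar>\<^sup>2 \<bar>u\<bar>\<^sup>2 vol / 2\<close>.\<close>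

lemma self_dual_conformal:
  fixes b :: "real^4 \<Rightarrow> real^4 \<Rightarrow> real"
  assumes b: "inner_form b" and \<beta>: "two_form \<beta>" and sd: "\<beta> = hodge_star b \<beta>"
  shows "b (sharp b (\<beta> u)) (sharp b (\<beta> u)) = form_inner b \<beta> \<beta> / 2 * b u u"
    and "form_inner b \<beta> \<beta> * sqrt (det (\<chi> i j. b (axis i 1) (axis j 1))) =
      wedge2 \<beta> \<beta> (axis 1 1) (axis 2 1) (axis 3 1) (axis 4 1)"
proof -
  let ?D = "sqrt (det (\<chi> i j. b (axis i 1) (axis j 1)))"
  have D: "?D \<noteq> 0" using gram_det_nonzero[OF b] by simp
  note bil = two_form_bilinear[OF \<beta>] and skew = two_form_skew[OF \<beta>]
  have z: "\<beta> u u = 0" for u using skew[of u u] by simp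
  have lin: "linear (\<beta> u)" for u using bil by (auto simp: bilinear_def)
  have w: "wedge2 \<alpha> \<beta> v1 v2 v3 v4 = form_inner b \<alpha> \<beta> * (?D * det (vector [v1, v2, v3, v4]))"
    if "two_form \<alpha>" for \<alpha> v1 v2 v3 v4
    using hodge_star[OF b \<beta> that] sd by (simp add: vol_form_def)
  show "form_inner b \<beta> \<beta> * ?D = wedge2 \<beta> \<beta> (axis 1 1) (axis 2 1) (axis 3 1) (axis 4 1)"
    using w[OF \<beta>] by (simp add: det_axes)
  show "b (sharp b (\<beta> u)) (sharp b (\<beta> u)) = form_inner b \<beta> \<beta> / 2 * b u u"
  proof (cases "u = 0")
    case True
    have "sharp b (\<beta> 0) = 0"
      using bil by (intro sharp_eqI[OF b]) (simp add: bilinear_lzero inner_form_simps[OF b])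
    then show ?thesis using True by (simp add: inner_form_simps[OF b])
  next
    case False
    have "\<exists>v2 v3 v4. det (vector [u, v2, v3, v4] :: real^4^4) \<noteq> 0"
    proof -
      have "u $ 1 \<noteq> 0 \<or> u $ 2 \<noteq> 0 \<or> u $ 3 \<noteq> 0 \<or> u $ 4 \<noteq> 0"
        using False by (simp add: vec_eq_iff forall_4)
      moreover have "det (vector [u, axis 2 1, axis 3 1, axis 4 1] :: real^4^4) = u $ 1"
        "det (vector [u, axis 1 1, axis 4 1, axis 3 1] :: real^4^4) = u $ 2"
        "det (vector [u, axis 1 1, axis 2 1, axis 4 1] :: real^4^4) = u $ 3"
        "det (vector [u, axis 1 1, axis 3 1, axis 2 1] :: real^4^4) = u $ 4"
        by (simp_all add: det_4 vector_4 axis_def)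
      ultimately show ?thesis by metis
    qed
    then obtain v2 v3 v4 where v: "det (vector [u, v2, v3, v4] :: real^4^4) \<noteq> 0" by blast
    define \<alpha> where "\<alpha> x y = b u x * \<beta> u y - \<beta> u x * b u y" for x y
    have bu: "linear (b u)" by (rule inner_form_linear_right[OF b])
    have "two_form \<alpha>"
      unfolding two_form_def bilinear_def \<alpha>_def
      by (intro conjI allI linearI)
        (simp_all add: linear_add[OF lin] linear_add[OF bu] linear_scale[OF lin] linear_scale[OF bu] algebra_simps)
    have s: "sharp b (b u) = u" by (rule sharp_eqI[OF b]) simp
    have fi: "form_inner b \<alpha> \<beta> = b (sharp b (\<beta> u)) (sharp b (\<beta> u))"
      unfolding \<alpha>_def form_inner_decomposable[OF b bil bu lin] s
      using skew[of u "sharp b (\<beta> u)"] by (simp add: inner_form_sharp[OF b lin])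
    \<comment> \<open>With \<open>u\<close> in the first slot, \<open>\<alpha> u\<close> is
      \<open>b u u * \<beta> u\<close>, and the remaining terms, such as
      \<open>\<alpha> v2 v3 * \<beta> u v4\<close>, cancel because \<open>\<beta> u\<close> occurs
      twice in each. This is why the basis was chosen to start with \<open>u\<close>.\<close>
    have "2 * wedge2 \<alpha> \<beta> u v2 v3 v4 = b u u * wedge2 \<beta> \<beta> u v2 v3 v4"
      by (simp add: wedge2_def \<alpha>_def z algebra_simps)
    then have "2 * b (sharp b (\<beta> u)) (sharp b (\<beta> u)) * (?D * det (vector [u, v2, v3, v4])) =
        b u u * form_inner b \<beta> \<beta> * (?D * det (vector [u, v2, v3, v4]))"
      unfolding w[OF \<open>two_form \<alpha>\<close>] w[OF \<beta>] fi by (simp only: mult.assoc)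
    moreover have "?D * det (vector [u, v2, v3, v4] :: real^4^4) \<noteq> 0" using D v by simp
    ultimately have "2 * b (sharp b (\<beta> u)) (sharp b (\<beta> u)) = b u u * form_inner b \<beta> \<beta>"
      using mult_right_cancel by blast
    then show ?thesis by (simp add: mult.commute)
  qed
qed

section \<open>Kaehler metrics in coordinates\<close>

lemma smooth_map_on_differentiable:
  "smooth_map_on S f \<Longrightarrow> x \<in> S \<Longrightarrow> f differentiable (at x)"
  unfolding smooth_map_on_def by (drule spec[of _ "Suc 0"]) simp

lemma smooth_map_on_dd: "smooth_map_on S f \<Longrightarrow> smooth_map_on S (\<lambda>x. dd f x v)"
  unfolding smooth_map_on_def by (rule allI, drule_tac x="Suc k" in spec) simp

lemma trace_commute:
  fixes A B :: "'e::euclidean_space \<Rightarrow> 'e"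
  assumes "linear A" "linear B"
  shows "(\<Sum>i\<in>Basis. A (B i) \<bullet> i) = (\<Sum>i\<in>Basis. B (A i) \<bullet> i)"
proof -
  have *: "(\<Sum>i\<in>Basis. A (B i) \<bullet> i) = (\<Sum>i\<in>Basis. \<Sum>j\<in>Basis. (B i \<bullet> j) * (A j \<bullet> i))"
    if A: "linear A" for A B :: "'e \<Rightarrow> 'e"
  proof (rule sum.cong[OF refl])
    fix i
    show "A (B i) \<bullet> i = (\<Sum>j\<in>Basis. (B i \<bullet> j) * (A j \<bullet> i))"
      using linear_sum_Basis[OF A, of "B i"] by (simp add: inner_sum_left)
  qed
  have "(\<Sum>i\<in>Basis. \<Sum>j\<in>Basis. (B i \<bullet> j) * (A j \<bullet> i)) = (\<Sum>i\<in>Basis. \<Sum>j\<in>Basis. (A i \<bullet> j) * (B j \<bullet> i))"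
    by (subst sum.swap) (simp only: mult.commute)
  then show ?thesis
    using *[OF assms(1), of B] *[OF assms(2), of A] by simp
qed

section \<open>The Levi-Civita connection and its curvature in a chart\<close>

locale metric_patch =
  fixes S :: "'e::euclidean_space set" and g :: "'e tensor2"
  assumes open_S: "open S"
    and inner_form_g: "x \<in> S \<Longrightarrow> inner_form (g x)"
    and smooth_g: "smooth_map_on S (\<lambda>x. g x u v)"
begin

abbreviation Dg :: "'e \<Rightarrow> 'e \<Rightarrow> 'e \<Rightarrow> 'e \<Rightarrow> real"
  where "Dg x u v w \<equiv> dd (\<lambda>y. g y v w) x u"

context
  fixes x assumes x: "x \<in> S"
begin

lemmas g_bilinear = inner_form_bilinear[OF inner_form_g]
lemmas g_sym = inner_form_sym[OF inner_form_g[OF x]]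
lemmas g_simps = inner_form_simps[OF inner_form_g[OF x]]

lemma g_differentiable: "(\<lambda>y. g y u v) differentiable (at x)"
  by (rule smooth_map_on_differentiable[OF smooth_g x])

lemma Dg_differentiable: "(\<lambda>y. Dg y u v w) differentiable (at x)"
  by (rule smooth_map_on_differentiable[OF smooth_map_on_dd[OF smooth_g] x])

lemma Dg_linear: "linear (\<lambda>u. Dg x u v w)" "linear (\<lambda>v. Dg x u v w)" "linear (\<lambda>w. Dg x u v w)"
proof -
  show "linear (\<lambda>u. Dg x u v w)" by (rule linear_dd[OF g_differentiable])
  have "bilinear (\<lambda>v w. Dg x u v w)"
    by (rule bilinear_dd[OF open_S x g_bilinear g_differentiable])
  then show "linear (\<lambda>v. Dg x u v w)" "linear (\<lambda>w. Dg x u v w)"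
    by (simp_all add: bilinear_def)
qed

lemma Dg_sym: "Dg x u v w = Dg x u w v"
proof -
  have "dd (\<lambda>y. g y v w) x = dd (\<lambda>y. g y w v) x"
    by (rule dd_cong_open[OF open_S x]) (rule inner_form_sym[OF inner_form_g])
  then show ?thesis by simp
qed

text \<open>The Koszul formula. It is the working form of \<open>christoffel\<close>: identities are
  verified by pairing with an arbitrary \<open>w\<close>.\<close>

lemma inner_christoffel:
  "g x (christoffel g x u v) w = (Dg x u v w + Dg x v u w - Dg x w u v) / 2"
proof -
  have "linear (\<lambda>w. (Dg x u v w + Dg x v u w - Dg x w u v) / 2)"
    by (intro linearI)
      (simp_all add: linear_add[OF Dg_linear(1)] linear_add[OF Dg_linear(3)]
        linear_scale[OF Dg_linear(1)] linear_scale[OF Dg_linear(3)] field_simps)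
  then show ?thesis
    unfolding christoffel_def by (rule inner_form_sharp[OF inner_form_g[OF x]])
qed

lemma christoffel_eqI:
  "(\<And>w. g x a w = (Dg x u v w + Dg x v u w - Dg x w u v) / 2) \<Longrightarrow> christoffel g x u v = a"
  by (rule inner_form_eqI[OF inner_form_g[OF x]]) (simp add: inner_christoffel)

lemma christoffel_sym: "christoffel g x u v = christoffel g x v u"
  by (rule christoffel_eqI) (simp add: inner_christoffel Dg_sym[of v u])

lemma christoffel_linear_right: "linear (\<lambda>v. christoffel g x u v)"
proof (rule linearI)
  fix v v' r
  show "christoffel g x u (v + v') = christoffel g x u v + christoffel g x u v'"
    by (rule christoffel_eqI)
      (simp add: g_simps inner_christoffel linear_add[OF Dg_linear(1)] linear_add[OF Dg_linear(2)]
        linear_add[OF Dg_linear(3)] field_simps)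
  show "christoffel g x u (r *\<^sub>R v) = r *\<^sub>R christoffel g x u v"
    by (rule christoffel_eqI)
      (simp add: g_simps inner_christoffel linear_scale[OF Dg_linear(1)] linear_scale[OF Dg_linear(2)]
        linear_scale[OF Dg_linear(3)] field_simps)
qed

lemma christoffel_linear_left: "linear (\<lambda>u. christoffel g x u v)"
  by (subst christoffel_sym) (rule christoffel_linear_right)

lemma metric_compatible:
  "Dg x u v w = g x (christoffel g x u v) w + g x v (christoffel g x u w)"
  using inner_christoffel[of u v w] inner_christoffel[of u w v] g_sym[of v "christoffel g x u w"]
    Dg_sym[of v w u] Dg_sym[of u w v] Dg_sym[of u v w] by argo

end

lemma christoffel_differentiable:
  assumes x: "x \<in> S"
  shows "(\<lambda>y. christoffel g y u v) differentiable (at x)"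
  unfolding christoffel_def
proof (rule sharp_differentiable[OF open_S x inner_form_g _ g_differentiable[OF x]])
  fix y assume y: "y \<in> S"
  show "linear (\<lambda>w. (Dg y u v w + Dg y v u w - Dg y w u v) / 2)"
    by (intro linearI)
      (simp_all add: linear_add[OF Dg_linear(1)] linear_add[OF Dg_linear(3)]
        linear_scale[OF Dg_linear(1)] linear_scale[OF Dg_linear(3)] field_simps y)
next
  fix w
  have "(\<lambda>y. (1 / 2) *\<^sub>R (Dg y u v w + Dg y v u w - Dg y w u v)) differentiable (at x)"
    by (intro differentiable_scaleR differentiable_const differentiable_diff differentiable_add
        Dg_differentiable x)
  then show "(\<lambda>y. (Dg y u v w + Dg y v u w - Dg y w u v) / 2) differentiable (at x)"
    by simp
qed

lemma riemann_curv_skew: "riemann_curv g x u v w = - riemann_curv g x v u w"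
  by (simp add: riemann_curv_def)

lemma bianchi:
  assumes x: "x \<in> S"
  shows "riemann_curv g x u v w + riemann_curv g x v w u + riemann_curv g x w u v = 0"
proof -
  have "dd (\<lambda>y. christoffel g y a b) x = dd (\<lambda>y. christoffel g y b a) x" for a b
    by (rule dd_cong_open[OF open_S x christoffel_sym])
  from this[of v w] this[of u w] this[of u v] show ?thesis
    by (simp add: riemann_curv_def christoffel_sym[OF x, of v w] christoffel_sym[OF x, of u w]
        christoffel_sym[OF x, of u v])
qed

end

section \<open>Kaehler metrics and the curvature of the canonical bundle\<close>

lemma J_linear: "linear (J :: complex^'n \<Rightarrow> complex^'n)"
  by (intro linearI) (simp_all add: J_def vec_eq_iff algebra_simps)

lemma J_bounded_linear: "bounded_linear (J :: complex^'n \<Rightarrow> complex^'n)"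
  using J_linear linear_conv_bounded_linear by blast

lemma J_J: "J (J v) = - v"
  by (simp add: J_def vec_eq_iff)

lemmas J_simps = linear_add[OF J_linear] linear_diff[OF J_linear] linear_neg[OF J_linear]
  linear_scale[OF J_linear] linear_0[OF J_linear] J_J

locale kaehler_patch = metric_patch S g
  for S :: "(complex^'n) set" and g :: "(complex^'n) tensor2" +
  assumes J_invariant: "x \<in> S \<Longrightarrow> g x (J u) (J v) = g x u v"
    and closed: "closed_two_form S (kaehler_form g)"
begin

lemma g_J_left: "x \<in> S \<Longrightarrow> g x (J u) v = - g x u (J v)"
  using J_invariant[of x u "J v"] by (simp add: J_J g_simps)

lemma Dg_J:
  assumes x: "x \<in> S"
  shows "Dg x u (J v) (J w) = Dg x u v w" and "Dg x u v (J w) = - Dg x u (J v) w"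
proof -
  have "dd (\<lambda>y. g y (J v) (J w)) x = dd (\<lambda>y. g y v w) x" for v w
    by (rule dd_cong_open[OF open_S x J_invariant])
  then show 1: "Dg x u (J v) (J w) = Dg x u v w" for v w
    by simp
  show "Dg x u v (J w) = - Dg x u (J v) w"
    using 1[of "J v" w] by (simp add: J_J linear_neg[OF Dg_linear(2)[OF x]])
qed

lemma Dg_closed:
  assumes x: "x \<in> S"
  shows "Dg x u (J v) w + Dg x v (J w) u + Dg x w (J u) v = 0"
  using closed[unfolded closed_two_form_def kaehler_form_def] x by simp

text \<open>\<open>J\<close> is parallel. It is constant in holomorphic coordinates, so only the
  Christoffel term is at stake, and closedness of the Kaehler form at \<open>(v, w, u)\<close> and
  at \<open>(J v, J w, u)\<close> supplies the cancellation in the Koszul formula.\<close>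

lemma christoffel_J:
  assumes x: "x \<in> S"
  shows "christoffel g x u (J v) = J (christoffel g x u v)"
proof (rule christoffel_eqI[OF x])
  fix w
  have "Dg x u (J (J v)) (J w) = - Dg x u v (J w)" "Dg x (J v) (J (J w)) u = - Dg x (J v) w u"
    by (simp_all add: J_J linear_neg[OF Dg_linear(2)[OF x]])
  then show "g x (J (christoffel g x u v)) w = (Dg x u (J v) w + Dg x (J v) u w - Dg x w u (J v)) / 2"
    unfolding g_J_left[OF x] inner_christoffel[OF x]
    using Dg_closed[OF x, of v w u] Dg_closed[OF x, of "J v" "J w" u]
      Dg_J(2)[OF x, of v w u] Dg_J(2)[OF x, of u w v] Dg_J(2)[OF x, of u v w]
      Dg_J(1)[OF x, of u v "J w"] Dg_sym[OF x, of w u "J v"] Dg_sym[OF x, of "J w" u v]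
    by argo
qed

lemma riemann_curv_J:
  assumes x: "x \<in> S"
  shows "riemann_curv g x u v (J w) = J (riemann_curv g x u v w)"
proof -
  have d: "dd (\<lambda>y. christoffel g y a (J w)) x b = J (dd (\<lambda>y. christoffel g y a w) x b)" for a b
  proof -
    have "dd (\<lambda>y. christoffel g y a (J w)) x = dd (\<lambda>y. J (christoffel g y a w)) x"
      by (rule dd_cong_open[OF open_S x]) (rule christoffel_J)
    moreover have "dd (\<lambda>y. J (christoffel g y a w)) x b = J (dd (\<lambda>y. christoffel g y a w) x b)"
      by (rule bounded_linear_dd[OF J_bounded_linear christoffel_differentiable[OF x]])
    ultimately show ?thesis by metis
  qed
  show ?thesis
    unfolding riemann_curv_def d christoffel_J[OF x] J_simps ..
qed

text \<open>Up to a factor, the imaginary part of the connection form of the canonical bundle.\<close>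

definition canonical_form :: "complex^'n \<Rightarrow> complex^'n \<Rightarrow> real"
  where "canonical_form x u = (\<Sum>i\<in>Basis. J (christoffel g x u i) \<bullet> i)"

lemma canonical_form_linear:
  assumes x: "x \<in> S"
  shows "linear (canonical_form x)"
proof -
  note l = christoffel_linear_left[OF x]
  show ?thesis
    by (intro linearI) (simp_all add: canonical_form_def linear_add[OF l] linear_scale[OF l]
        J_simps inner_add_left sum.distrib sum_distrib_left)
qed

lemma canonical_form_has_derivative:
  assumes x: "x \<in> S"
  shows "((\<lambda>y. canonical_form y u) has_derivative
    (\<lambda>z. \<Sum>i\<in>Basis. J (dd (\<lambda>y. christoffel g y u i) x z) \<bullet> i)) (at x)"
  unfolding canonical_form_def
proof (intro has_derivative_sum has_derivative_inner_left)
  fix i :: "complex^'n"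
  show "((\<lambda>y. J (christoffel g y u i)) has_derivative (\<lambda>z. J (dd (\<lambda>y. christoffel g y u i) x z))) (at x)"
    by (rule bounded_linear.has_derivative[OF J_bounded_linear dd_works[OF christoffel_differentiable[OF x]]])
qed

lemma canonical_form_differentiable: "x \<in> S \<Longrightarrow> (\<lambda>y. canonical_form y u) differentiable (at x)"
  by (rule differentiableI[OF canonical_form_has_derivative])

text \<open>The terms quadratic in \<open>christoffel\<close> cancel in the trace, since traces of
  products commute and \<open>J\<close> commutes with the connection.\<close>

lemma d_canonical_form:
  assumes x: "x \<in> S"
  shows "dd (\<lambda>y. canonical_form y v) x u - dd (\<lambda>y. canonical_form y u) x v =
    (\<Sum>i\<in>Basis. J (riemann_curv g x u v i) \<bullet> i)"
proof -
  have l: "linear (\<lambda>w. christoffel g x u w)" for u by (rule christoffel_linear_right[OF x])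
  have "(\<Sum>i\<in>Basis. J (christoffel g x u (christoffel g x v i)) \<bullet> i) =
      (\<Sum>i\<in>Basis. christoffel g x v (J (christoffel g x u i)) \<bullet> i)"
    using trace_commute[of "\<lambda>w. J (christoffel g x u w)" "christoffel g x v"]
      linear_compose[OF l J_linear] l by (simp add: o_def)
  then have "(\<Sum>i\<in>Basis. J (christoffel g x u (christoffel g x v i)) \<bullet> i) =
      (\<Sum>i\<in>Basis. J (christoffel g x v (christoffel g x u i)) \<bullet> i)"
    by (simp add: christoffel_J[OF x])
  then show ?thesis
    unfolding dd_eqI[OF canonical_form_has_derivative[OF x]] riemann_curv_def
    by (simp add: J_simps inner_diff_left inner_add_left sum.distrib sum_subtractf)
qed

text \<open>The first Bianchi identity turns \<open>R(u,v)i\<close> into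
  \<open>R(i,v)u - R(i,u)v\<close>, and \<open>J\<close> moves into the last argument. The trace
  becomes \<open>ricci g x v (J u) - ricci g x u (J v)\<close>; both terms contribute
  \<open>k\<close> times the Kaehler form, hence the factor 2.\<close>

lemma einstein_trace:
  assumes x: "x \<in> S" and ric: "\<And>u v. ricci g x u v = k * g x u v"
  shows "(\<Sum>i\<in>Basis. J (riemann_curv g x u v i) \<bullet> i) = 2 * k * kaehler_form g x u v"
proof -
  have "J (riemann_curv g x u v i) \<bullet> i = riemann_curv g x i v (J u) \<bullet> i - riemann_curv g x i u (J v) \<bullet> i" for i
  proof -
    have "riemann_curv g x u v i = riemann_curv g x i v u - riemann_curv g x i u v"
      using bianchi[OF x, of u v i] unfolding riemann_curv_skew[of x v i u] add.assoc eq_neg_iff_add_eq_0[symmetric]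
      by simp
    then show ?thesis by (simp add: riemann_curv_J[OF x] J_simps inner_diff_left)
  qed
  then have "(\<Sum>i\<in>Basis. J (riemann_curv g x u v i) \<bullet> i) = ricci g x v (J u) - ricci g x u (J v)"
    by (simp add: ricci_def sum_subtractf)
  then show ?thesis
    by (simp add: ric kaehler_form_def g_J_left[OF x, of u v] g_sym[OF x, of v "J u"] algebra_simps)
qed

end

section \<open>Immersions in coordinates\<close>

lemma axis_expansion: "(v :: 'a::semiring_1^'n) = (\<Sum>j\<in>UNIV. v $ j *s axis j 1)"
  by (simp add: vec_eq_iff axis_def if_distrib cong: if_cong)

lemma real_axis_expansion: "(v :: real^'n) = (\<Sum>j\<in>UNIV. v $ j *\<^sub>R axis j 1)"
  by (simp add: vec_eq_iff axis_def if_distrib cong: if_cong)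

lemma complex_scale_eq: "(c :: complex) *s v = Re c *\<^sub>R v + Im c *\<^sub>R J v"
  by (simp add: J_def vec_eq_iff complex_eq_iff)

lemma commute_J_imp_complex_linear:
  assumes "linear A" "\<And>v. A (J v) = J (A v)"
  shows "A v = (\<Sum>j\<in>UNIV. v $ j *s A (axis j 1))"
proof -
  have "A v = A (\<Sum>j\<in>UNIV. v $ j *s axis j 1)"
    using axis_expansion[of v] by simp
  also have "\<dots> = (\<Sum>j\<in>UNIV. v $ j *s A (axis j 1))"
    by (simp add: linear_sum[OF assms(1)] complex_scale_eq linear_add[OF assms(1)]
        linear_scale[OF assms(1)] assms(2))
  finally show ?thesis .
qed

lemma sum_Basis_complex_vec:
  "(\<Sum>b\<in>(Basis :: (complex^'n) set). h b) = (\<Sum>i\<in>UNIV. h (axis i 1) + h (axis i \<i>))"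
proof -
  have B: "(Basis :: (complex^'n) set) = (\<lambda>(i, u). axis i u) ` (UNIV \<times> Basis)"
    by (auto simp: Basis_vec_def)
  have inj: "inj_on (\<lambda>(i, u). axis i u :: complex^'n) (UNIV \<times> Basis)"
    by (auto simp: inj_on_def axis_eq_axis)
  show ?thesis
    unfolding B sum.reindex[OF inj] by (simp add: sum.cartesian_product' Basis_complex_def)
qed

lemma sum_Basis_real_vec:
  "(\<Sum>b\<in>(Basis :: (real^'n) set). h b) = (\<Sum>i\<in>UNIV. h (axis i 1))"
proof -
  have B: "(Basis :: (real^'n) set) = (\<lambda>i. axis i 1) ` UNIV"
    by (auto simp: Basis_vec_def)
  have inj: "inj (\<lambda>i. axis i 1 :: real^'n)"
    by (auto simp: inj_on_def axis_eq_axis)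
  show ?thesis
    unfolding B sum.reindex[OF inj] by simp
qed

text \<open>The real trace of a complex linear map is twice the real part of its complex trace, and
  \<open>Re (\<i> * z) = - Im z\<close>.\<close>

lemma trace_J_complex_linear:
  fixes A :: "complex^'n \<Rightarrow> complex^'n"
  assumes "\<And>v. A (J v) = J (A v)"
  shows "(\<Sum>i\<in>Basis. J (A i) \<bullet> i) = - 2 * Im (\<Sum>k\<in>UNIV. A (axis k 1) $ k)"
proof -
  have "axis k \<i> = J (axis k 1 :: complex^'n)" for k
    by (simp add: J_def vec_eq_iff axis_def)
  then have *: "A (axis k \<i>) = J (A (axis k 1))" for k
    using assms by simp
  have "J (A (axis k 1)) \<bullet> axis k 1 + J (A (axis k \<i>)) \<bullet> axis k \<i> = - 2 * Im (A (axis k 1) $ k)" for k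
    unfolding * J_J inner_minus_left inner_axis by (simp add: J_def inner_complex_def)
  then show ?thesis
    by (simp add: sum_Basis_complex_vec sum_distrib_left)
qed

text \<open>With \<open>L\<close> the matrix of \<open>A\<close> on the standard basis, the
  hypothesis reads \<open>M ** E = E ** L\<close>, so \<open>M\<close> and \<open>L\<close> are
  similar.\<close>

lemma trace_conjugate:
  fixes E :: "complex^'n^'n"
  assumes E: "det E \<noteq> 0" and A: "linear A" "\<And>v. A (J v) = J (A v)"
    and M: "\<And>k. A (E $ k) = (\<Sum>j\<in>UNIV. M $ k $ j *s E $ j)"
  shows "trace M = (\<Sum>k\<in>UNIV. A (axis k 1) $ k)"
proof -
  define L where "L = (\<chi> j. A (axis j 1))"
  obtain E' where E': "E ** E' = mat 1" "E' ** E = mat 1"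
    using E unfolding invertible_det_nz[symmetric] invertible_def by blast
  have "M ** E = E ** L"
    using M commute_J_imp_complex_linear[OF A, of "E $ k" for k]
    by (simp add: vec_eq_iff matrix_matrix_mult_def L_def)
  then have "M = E ** (L ** E')"
    using E' by (metis matrix_mul_assoc matrix_mul_rid)
  then have "trace M = trace L"
    using E' by (metis matrix_mul_assoc matrix_mul_rid trace_mul_sym)
  then show ?thesis by (simp add: trace_def L_def)
qed

lemma row_combination:
  fixes E :: "complex^'n^'n"
  assumes "det E \<noteq> 0"
  obtains x where "h = (\<Sum>j\<in>UNIV. x $ j *s E $ j)"
proof -
  have "invertible (transpose E)" using assms by (simp add: invertible_det_nz)
  then obtain E' where "transpose E ** E' = mat 1" unfolding invertible_def by blast
  then have "transpose E *v (E' *v h) = h" by (simp add: matrix_vector_mul_assoc)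
  then have "h = (\<Sum>j\<in>UNIV. (E' *v h) $ j *s E $ j)"
    by (simp add: vec_eq_iff matrix_vector_mult_def transpose_def mult.commute)
  then show ?thesis by (rule that)
qed

section \<open>The Kaehler angle in a pair of charts\<close>

locale kaehler_immersion = kaehler_patch S g
  for S :: "(complex^4) set" and g :: "(complex^4) tensor2" +
  fixes U :: "(real^4) set" and f :: "real^4 \<Rightarrow> complex^4"
  assumes open_U: "open U" and image_f: "y \<in> U \<Longrightarrow> f y \<in> S"
    and smooth_f: "smooth_map_on U f" and inj_df: "y \<in> U \<Longrightarrow> inj (dd f y)"
    and minimal: "y \<in> U \<Longrightarrow> mean_curvature g f y = 0"
    and cayley: "y \<in> U \<Longrightarrow>
      pullback f (kaehler_form g) y = hodge_star (pullback f g y) (pullback f (kaehler_form g) y)"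
begin

abbreviation G where "G \<equiv> pullback f g"
abbreviation W where "W \<equiv> pullback f (kaehler_form g)"

lemma G_eq: "G y u v = g (f y) (dd f y u) (dd f y v)"
  by (simp add: pullback_def)

lemma W_eq: "W y u v = g (f y) (J (dd f y u)) (dd f y v)"
  by (simp add: pullback_def kaehler_form_def)

text \<open>The endomorphism with \<open>\<omega> = G(P\<cdot>,\<cdot>)\<close>, and \<open>P\<^sup>2 = - angle\<close>: in the notation of the equal Kaehler
  angle literature, \<open>angle = cos\<^sup>2 \<theta>\<close>.\<close>

definition P :: "real^4 \<Rightarrow> real^4 \<Rightarrow> real^4"
  where "P y u = sharp (G y) (W y u)"

definition angle :: "real^4 \<Rightarrow> real"
  where "angle y = form_inner (G y) (W y) (W y) / 2"

text \<open>The covariant derivative of \<open>df\<close>.\<close>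

definition hess :: "real^4 \<Rightarrow> real^4 \<Rightarrow> real^4 \<Rightarrow> complex^4"
  where "hess y u v = dd (\<lambda>z. dd f z v) y u + christoffel g (f y) (dd f y u) (dd f y v)"

context
  fixes y assumes y: "y \<in> U"
begin

lemmas gS = inner_form_g[OF image_f[OF y]]
lemmas gs = inner_form_simps[OF gS]
lemmas gsym = inner_form_sym[OF gS]

lemma df_differentiable: "f differentiable (at y)"
  by (rule smooth_map_on_differentiable[OF smooth_f y])

lemma ddf_differentiable: "(\<lambda>z. dd f z v) differentiable (at y)"
  by (rule smooth_map_on_differentiable[OF smooth_map_on_dd[OF smooth_f] y])

lemma linear_df: "linear (dd f y)"
  by (rule linear_dd[OF df_differentiable])

lemmas df_simps = linear_add[OF linear_df] linear_diff[OF linear_df] linear_neg[OF linear_df]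
  linear_scale[OF linear_df] linear_0[OF linear_df]

lemma df_eq_0: "dd f y u = 0 \<longleftrightarrow> u = 0"
  using inj_df[OF y] linear_df by (metis injD linear_0)

lemma G_inner_form: "inner_form (G y)"
proof -
  have "bilinear (G y)"
    unfolding bilinear_def G_eq
    by (intro conjI allI linearI) (simp_all add: df_simps gs)
  moreover have "G y u v = G y v u" for u v unfolding G_eq by (rule gsym)
  moreover have "G y u u > 0" if "u \<noteq> 0" for u
    unfolding G_eq using that df_eq_0 by (intro inner_form_pos[OF gS]) simp
  ultimately show ?thesis unfolding inner_form_def by blast
qed

lemmas G_simps = inner_form_simps[OF G_inner_form]
lemmas G_sym = inner_form_sym[OF G_inner_form]

lemma W_two_form: "two_form (W y)"
proof -
  have "bilinear (W y)"
    unfolding bilinear_def W_eq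
    by (intro conjI allI linearI) (simp_all add: df_simps gs J_simps)
  moreover have "W y u v = - W y v u" for u v
    unfolding W_eq g_J_left[OF image_f[OF y], of "dd f y u"] by (simp add: gsym)
  ultimately show ?thesis unfolding two_form_def by blast
qed

lemmas W_linear = two_form_linear[OF W_two_form]
lemmas W_skew = two_form_skew[OF W_two_form]

lemma G_P: "G y (P y u) v = W y u v" "G y v (P y u) = W y u v"
  unfolding P_def using inner_form_sharp[OF G_inner_form W_linear(2)] inner_form_sharp'[OF G_inner_form W_linear(2)]
  by auto

lemma P_linear: "linear (P y)"
proof (rule linearI)
  fix u v r
  show "P y (u + v) = P y u + P y v"
    by (rule inner_form_eqI[OF G_inner_form]) (simp add: G_simps G_P linear_add[OF W_linear(1)])
  show "P y (r *\<^sub>R u) = r *\<^sub>R P y u"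
    by (rule inner_form_eqI[OF G_inner_form]) (simp add: G_simps G_P linear_scale[OF W_linear(1)])
qed

lemma P_skew: "G y (P y u) v = - G y u (P y v)"
  unfolding G_P by (rule W_skew)

lemma G_P_P_diag: "G y (P y u) (P y u) = angle y * G y u u"
  unfolding P_def angle_def
  by (rule self_dual_conformal(1)[OF G_inner_form W_two_form cayley[OF y]])

lemma G_P_P: "G y (P y u) (P y v) = angle y * G y u v"
proof -
  have "G y (P y (u + v)) (P y (u + v)) = angle y * G y (u + v) (u + v)"
    by (rule G_P_P_diag)
  then have "G y (P y u) (P y v) + G y (P y v) (P y u) = angle y * (G y u v + G y v u)"
    by (simp add: linear_add[OF P_linear] G_simps G_P_P_diag algebra_simps)
  then show ?thesis
    using G_sym[of "P y v" "P y u"] G_sym[of v u] by simp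
qed

lemma P_P: "P y (P y u) = - angle y *\<^sub>R u"
proof (rule inner_form_eqI[OF G_inner_form])
  fix w
  show "G y (P y (P y u)) w = G y (- angle y *\<^sub>R u) w"
    unfolding P_skew[of "P y u"] G_P_P by (simp add: G_simps)
qed

text \<open>For a self-dual form, its wedge square is its squared norm times the volume form. The
  resulting quotient involves only \<open>W\<close> and a Gram determinant, so it is visibly
  differentiable.\<close>

lemma angle_eq:
  "angle y = wedge2 (W y) (W y) (axis 1 1) (axis 2 1) (axis 3 1) (axis 4 1)
    / (2 * sqrt (det (\<chi> i j. G y (axis i 1) (axis j 1))))"
  using self_dual_conformal(2)[OF G_inner_form W_two_form cayley[OF y]] gram_det_nonzero[OF G_inner_form]
  by (simp add: angle_def field_simps)

text \<open>\<open>dd f y (P y u)\<close> is the tangential part of \<open>J (dd f y u)\<close>, and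
  Pythagoras splits the length by \<open>angle\<close> and \<open>1 - angle\<close>. This yields
  \<open>angle y \<le> 1\<close>, complex tangent spaces at 1 and total reality below 1.\<close>

lemma normal_component:
  "g (f y) (J (dd f y u) - dd f y (P y u)) (dd f y v) = 0"
  "g (f y) (J (dd f y u) - dd f y (P y u)) (J (dd f y u) - dd f y (P y u)) = (1 - angle y) * G y u u"
proof -
  show 1: "g (f y) (J (dd f y u) - dd f y (P y u)) (dd f y v) = 0" for v
    using G_P(1)[of u v] unfolding W_eq G_eq by (simp add: gs)
  have "g (f y) (J (dd f y u) - dd f y (P y u)) (J (dd f y u) - dd f y (P y u))
      = g (f y) (J (dd f y u) - dd f y (P y u)) (J (dd f y u))"
    using 1[of "P y u"] by (simp add: gs)
  also have "\<dots> = G y u u - g (f y) (J (dd f y u)) (dd f y (P y u))"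
    unfolding G_eq by (simp add: gs J_invariant[OF image_f[OF y]] gsym[of "dd f y (P y u)"])
  also have "\<dots> = (1 - angle y) * G y u u"
    using G_P(1)[of u "P y u"] G_P_P_diag[of u] unfolding W_eq by (simp add: algebra_simps)
  finally show "g (f y) (J (dd f y u) - dd f y (P y u)) (J (dd f y u) - dd f y (P y u)) = (1 - angle y) * G y u u" .
qed

lemma angle_bounds: "0 \<le> angle y" "angle y \<le> 1"
proof -
  let ?u = "axis 1 1 :: real^4"
  have pos: "G y ?u ?u > 0" by (rule inner_form_pos[OF G_inner_form]) (simp add: axis_eq_0_iff)
  have "0 \<le> angle y * G y ?u ?u"
    unfolding G_P_P_diag[symmetric] by (rule inner_form_nonneg[OF G_inner_form])
  then show "0 \<le> angle y" using pos by (simp add: zero_le_mult_iff)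
  have "0 \<le> (1 - angle y) * G y ?u ?u"
    unfolding normal_component(2)[symmetric] by (rule inner_form_nonneg[OF gS])
  then show "angle y \<le> 1" using pos by (simp add: zero_le_mult_iff)
qed

lemma angle_0_lagrangian:
  assumes "angle y = 0"
  shows "W y u v = 0"
proof -
  have "P y u = 0"
    using G_P_P_diag[of u] assms inner_form_zero_iff[OF G_inner_form] by simp
  then show ?thesis using G_P(1)[of u v] by (simp add: G_simps)
qed

text \<open>The normal part of \<open>J (dd f y u)\<close> has length zero, so \<open>J\<close> acts
  on the tangent space as \<open>P\<close>. The reverse inclusion uses that \<open>P\<close> squares
  to -1.\<close>

lemma angle_1_complex:
  assumes "angle y = 1"
  shows "J ` range (dd f y) = range (dd f y)"
proof -
  have J: "J (dd f y u) = dd f y (P y u)" for u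
    using normal_component(2)[of u] assms inner_form_zero_iff[OF gS] by simp
  then have "dd f y u = J (dd f y (- P y u))" for u
    using J[of "P y u"] P_P[of u] assms by (simp add: df_simps J_simps)
  then show ?thesis using J by (auto simp: image_iff) blast+
qed

text \<open>Such a relation makes the normal part of \<open>J (dd f y v)\<close> tangent, hence
  orthogonal to itself, while its squared length is \<open>(1 - angle y) * G y v v\<close>.\<close>

lemma totally_real:
  assumes c: "angle y < 1" and 0: "dd f y u + J (dd f y v) = 0"
  shows "u = 0 \<and> v = 0"
proof -
  have "J (dd f y v) - dd f y (P y v) = dd f y (- u - P y v)"
    using 0 by (simp add: df_simps add_eq_0_iff)
  then have "(1 - angle y) * G y v v = 0"
    using normal_component(1)[of v "- u - P y v"] normal_component(2)[of v] by simp
  then have "v = 0" using c inner_form_zero_iff[OF G_inner_form] by simp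
  then show ?thesis using 0 df_eq_0 by (simp add: df_simps J_simps)
qed

lemma hess_sym: "hess y u v = hess y v u"
proof -
  have "dd (\<lambda>z. dd f z v) y u = dd (\<lambda>z. dd f z u) y v"
    using smooth_map_on_differentiable[OF smooth_f]
    by (intro dd_dd_symmetric[OF open_U y] ddf_differentiable)
  then show ?thesis
    unfolding hess_def christoffel_sym[OF image_f[OF y], of "dd f y u"] by simp
qed

lemma hess_linear_left: "linear (\<lambda>u. hess y u v)"
proof -
  note l = linear_dd[OF ddf_differentiable] christoffel_linear_left[OF image_f[OF y]]
  show ?thesis
    unfolding hess_def
    by (rule linearI) (simp_all add: linear_add[OF l(1)] linear_add[OF l(2)] linear_scale[OF l(1)]
        linear_scale[OF l(2)] df_simps scaleR_add_right)
qed

lemma hess_linear_right: "linear (\<lambda>v. hess y u v)"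
  unfolding hess_sym[of u] by (rule hess_linear_left)

lemma inner_has_derivative:
  assumes a: "a differentiable (at y)" and b: "b differentiable (at y)"
  shows "((\<lambda>z. g (f z) (a z) (b z)) has_derivative (\<lambda>w.
      g (f y) (dd a y w + christoffel g (f y) (dd f y w) (a y)) (b y)
      + g (f y) (a y) (dd b y w + christoffel g (f y) (dd f y w) (b y)))) (at y)"
proof -
  have "f ` U \<subseteq> S" using image_f by blast
  from has_derivative_tensor[where h=g and f=f and y=y, OF open_S image_f[OF y] inner_form_bilinear[OF inner_form_g]
      g_differentiable[OF image_f[OF y]] open_U y this dd_works[OF df_differentiable] dd_works[OF a] dd_works[OF b]]
  show ?thesis
    by (rule has_derivative_eq_rhs) (assumption, intro ext, simp only: gs metric_compatible[OF image_f[OF y]] add_ac)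
qed

lemma G_has_derivative:
  "((\<lambda>z. G z u v) has_derivative (\<lambda>w. g (f y) (hess y w u) (dd f y v) + g (f y) (dd f y u) (hess y w v))) (at y)"
  unfolding G_eq hess_def by (rule inner_has_derivative[OF ddf_differentiable ddf_differentiable])

text \<open>Since \<open>J\<close> is parallel, it passes through the covariant derivative and only
  \<open>hess\<close> terms arise.\<close>

lemma W_has_derivative:
  "((\<lambda>z. W z u v) has_derivative (\<lambda>w. g (f y) (J (dd f y u)) (hess y w v) - g (f y) (hess y w u) (J (dd f y v)))) (at y)"
proof -
  have dJ: "((\<lambda>z. J (dd f z u)) has_derivative (\<lambda>w. J (dd (\<lambda>z. dd f z u) y w))) (at y)"
    by (rule bounded_linear.has_derivative[OF J_bounded_linear dd_works[OF ddf_differentiable]])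
  show ?thesis
    unfolding W_eq
    by (rule has_derivative_eq_rhs[OF inner_has_derivative[OF differentiableI[OF dJ] ddf_differentiable]])
      (simp add: fun_eq_iff dd_eqI[OF dJ] christoffel_J[OF image_f[OF y]] hess_def J_simps(1)[symmetric]
        g_J_left[OF image_f[OF y]] del: J_simps)
qed

end

end

text \<open>The real \<open>sqrt\<close> is extended to negative numbers as an odd function, so it
  is differentiable away from 0. This fits \<open>gram_det_nonzero\<close>, which states only that
  the determinant does not vanish.\<close>

lemma differentiable_sqrt:
  fixes h :: "'a::real_normed_vector \<Rightarrow> real"
  assumes "h differentiable (at x)" "h x \<noteq> 0"
  shows "(\<lambda>y. sqrt (h y)) differentiable (at x)"
proof -
  have "(sqrt has_real_derivative (if h x > 0 then inverse (sqrt (h x)) / 2 else - inverse (sqrt (h x)) / 2)) (at (h x))"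
    using assms(2) by (intro DERIV_real_sqrt_generic) auto
  then have "sqrt differentiable (at (h x))"
    unfolding has_field_derivative_def by (rule differentiableI)
  from differentiable_chain_at[OF assms(1) this] show ?thesis
    by (simp only: o_def)
qed

context kaehler_immersion
begin

lemma angle_differentiable:
  assumes y: "y \<in> U"
  shows "angle differentiable (at y)"
proof -
  have dG: "(\<lambda>z. G z u v) differentiable (at y)" for u v
    by (rule differentiableI[OF G_has_derivative[OF y]])
  have dW: "(\<lambda>z. W z u v) differentiable (at y)" for u v
    by (rule differentiableI[OF W_has_derivative[OF y]])
  let ?M = "\<lambda>z. \<chi> i j. G z (axis i 1) (axis j 1)"
  have "((\<lambda>z. ?M z $ i $ j) has_derivative
      (\<lambda>w. (\<chi> i j. dd (\<lambda>z. G z (axis i 1) (axis j 1)) y w) $ i $ j)) (at y)" for i j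
    using dd_works[OF dG] by simp
  from differentiableI[OF has_derivative_det[OF this]]
  have "(\<lambda>z. det (?M z)) differentiable (at y)" .
  then have "(\<lambda>z. sqrt (det (?M z))) differentiable (at y)"
    by (rule differentiable_sqrt) (rule gram_det_nonzero[OF G_inner_form[OF y]])
  moreover have "2 * sqrt (det (?M y)) \<noteq> 0"
    using gram_det_nonzero[OF G_inner_form[OF y]] by simp
  ultimately have "(\<lambda>z. wedge2 (W z) (W z) (axis 1 1) (axis 2 1) (axis 3 1) (axis 4 1)
      / (2 * sqrt (det (?M z)))) differentiable (at y)"
    unfolding wedge2_def
    by (intro differentiable_divide differentiable_add differentiable_diff differentiable_mult dW
        differentiable_const)
  then show ?thesis
    by (rule differentiable_cong_open[OF open_U y angle_eq, rotated])
qed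

text \<open>The second fundamental form, paired with the normal component of \<open>J df w\<close>.\<close>

definition sff :: "real^4 \<Rightarrow> real^4 \<Rightarrow> real^4 \<Rightarrow> real^4 \<Rightarrow> real"
  where "sff y u v w = g (f y) (hess y u v) (J (dd f y w) - dd f y (P y w))"

text \<open>The determinant of this matrix is the value of the holomorphic form
  \<open>dz1 dz2 dz3 dz4\<close> on the coordinate frame of the submanifold, that is, the
  trivialisation of the canonical bundle in coordinates.\<close>

definition frame :: "real^4 \<Rightarrow> complex^4^4"
  where "frame y = (\<chi> i. dd f y (axis i 1))"

context
  fixes y assumes y: "y \<in> U"
begin

text \<open>The function \<open>z \<mapsto> \<bar>P\<^sub>z u - P\<^sub>y u\<bar>\<^sup>2\<close> is minimal at \<open>z = y\<close>, which expresses the derivative of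
  \<open>P\<^sup>2 = - angle\<close> without differentiating \<open>P\<close>.\<close>

lemma dd_angle:
  "dd angle y w * G y u u + 2 * angle y * g (f y) (hess y w u) (dd f y u)
    + 2 * g (f y) (hess y w u) (J (dd f y (P y u))) - 2 * g (f y) (hess y w (P y u)) (J (dd f y u))
    + 2 * g (f y) (hess y w (P y u)) (dd f y (P y u)) = 0"
proof -
  let ?v = "P y u"
  let ?\<phi> = "\<lambda>z. angle z * G z u u - 2 * W z u ?v + G z ?v ?v"
  have eq: "?\<phi> z = G z (P z u - ?v) (P z u - ?v)" if "z \<in> U" for z
  proof -
    have "G z (a - ?v) (a - ?v) = G z a a - 2 * G z a ?v + G z ?v ?v" for a
      using G_sym[OF that, of ?v a] by (simp add: G_simps[OF that])
    from this[of "P z u"] show ?thesis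
      using G_P_P_diag[OF that, of u] G_P(1)[OF that, of u ?v] by simp
  qed
  have d: "(?\<phi> has_derivative (\<lambda>w. angle y * (g (f y) (hess y w u) (dd f y u) + g (f y) (dd f y u) (hess y w u))
       + dd angle y w * G y u u
       - 2 * (g (f y) (J (dd f y u)) (hess y w ?v) - g (f y) (hess y w u) (J (dd f y ?v)))
       + (g (f y) (hess y w ?v) (dd f y ?v) + g (f y) (dd f y ?v) (hess y w ?v)))) (at y)"
    by (intro has_derivative_add has_derivative_diff has_derivative_mult has_derivative_mult_right
        G_has_derivative W_has_derivative dd_works[OF angle_differentiable] y)
  have "\<forall>z\<in>U. ?\<phi> y \<le> ?\<phi> z"
  proof
    fix z assume z: "z \<in> U"
    have "?\<phi> y = 0" unfolding eq[OF y] by (simp add: G_simps[OF y])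
    also have "0 \<le> ?\<phi> z" unfolding eq[OF z] by (rule inner_form_nonneg[OF G_inner_form[OF z]])
    finally show "?\<phi> y \<le> ?\<phi> z" .
  qed
  from differential_zero_maxmin[OF y open_U d disjI2[OF this]]
  have "angle y * (g (f y) (hess y w u) (dd f y u) + g (f y) (dd f y u) (hess y w u))
       + dd angle y w * G y u u
       - 2 * (g (f y) (J (dd f y u)) (hess y w ?v) - g (f y) (hess y w u) (J (dd f y ?v)))
       + (g (f y) (hess y w ?v) (dd f y ?v) + g (f y) (dd f y ?v) (hess y w ?v)) = 0"
    by (rule fun_cong)
  then show ?thesis
    unfolding gsym[OF y, of "dd f y _" "hess y w _"] gsym[OF y, of "J _" "hess y w _"]
    by (simp add: algebra_simps)
qed

lemma sff_sym: "sff y u v w = sff y v u w"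
  unfolding sff_def hess_sym[OF y, of u] ..

lemma sff_linear: "linear (\<lambda>u. sff y u v w)" "linear (\<lambda>v. sff y u v w)" "linear (\<lambda>w. sff y u v w)"
proof -
  note gl = inner_form_linear_left[OF gS[OF y]]
  show "linear (\<lambda>u. sff y u v w)"
    using linear_compose[OF hess_linear_left[OF y] gl] by (simp only: sff_def o_def)
  show "linear (\<lambda>v. sff y u v w)"
    using linear_compose[OF hess_linear_right[OF y] gl] by (simp only: sff_def o_def)
  have "linear (\<lambda>w. J (dd f y w) - dd f y (P y w))"
    using linear_compose[OF linear_df[OF y] J_linear] linear_compose[OF P_linear[OF y] linear_df[OF y]]
    by (intro linear_compose_sub) (simp_all only: o_def)
  from linear_compose[OF this inner_form_linear_right[OF gS[OF y]]]
  show "linear (\<lambda>w. sff y u v w)"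
    by (simp only: sff_def o_def)
qed

text \<open>The tangential part of \<open>hess\<close> is orthogonal to the normal vector in
  \<open>sff\<close>, and the tangential part of \<open>J (dd f y w)\<close> is orthogonal to the
  second fundamental form.\<close>

lemma sff_eq:
  "sff y u v w = g (f y) (second_fundamental_form g f y u v) (J (dd f y w))"
proof -
  let ?t = "sharp (G y) (\<lambda>w. g (f y) (hess y u v) (dd f y w))"
  have "linear (\<lambda>w. g (f y) (hess y u v) (dd f y w))"
    by (intro linearI) (simp_all add: df_simps[OF y] gs[OF y])
  then have t: "g (f y) (dd f y ?t) (dd f y w) = g (f y) (hess y u v) (dd f y w)" for w
    using inner_form_sharp[OF G_inner_form[OF y]] unfolding G_eq by blast
  have n: "second_fundamental_form g f y u v = hess y u v - dd f y ?t"
    unfolding second_fundamental_form_def hess_def[symmetric]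
    by (rule normal_part_inner[OF gS[OF y] linear_df[OF y] inj_df[OF y]]) (simp add: t)
  have "g (f y) (dd f y ?t) (J (dd f y w)) = g (f y) (dd f y ?t) (dd f y (P y w))"
    using G_P(2)[OF y, of ?t w] unfolding G_eq W_eq gsym[OF y, of "dd f y ?t"] by simp
  then show ?thesis
    unfolding n sff_def t by (simp add: gs[OF y] t)
qed

lemma sff_trace: "(\<Sum>i\<in>Basis. sff y i (dual (G y) i) w) = 0"
proof -
  have "(\<Sum>i\<in>Basis. second_fundamental_form g f y i (dual (G y) i)) = 0"
    using minimal[OF y] unfolding mean_curvature_def metric_trace_dual[OF G_inner_form[OF y]]
    by simp
  then have "g (f y) (\<Sum>i\<in>Basis. second_fundamental_form g f y i (dual (G y) i)) (J (dd f y w)) = 0"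
    by (simp add: gs[OF y])
  then show ?thesis
    by (simp add: sff_eq linear_sum[OF inner_form_linear_left[OF gS[OF y]]])
qed

text \<open>\<open>N\<close> is the covariant derivative of omega|N expressed by \<open>sff\<close>.
  Its divergence vanishes by \<open>divergence_zero\<close>; of the two contractions in it, one
  vanishes by minimality (\<open>sff_trace\<close>), so the other does too.\<close>

lemma sff_divergence:
  assumes c: "angle y \<noteq> 0"
  shows "(\<Sum>i\<in>Basis. sff y w i (dual (G y) i)) = 0"
proof -
  define N where "N u v x = sff y u x v - sff y u v x" for u v x
  have l: "linear (\<lambda>u. N u v x)" "linear (\<lambda>v. N u v x)" "linear (\<lambda>x. N u v x)" for u v x
    unfolding N_def
    by (intro linearI; simp add: sff_linear[THEN linear_add] sff_linear[THEN linear_scale] algebra_simps)+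
  have dl: "linear (\<lambda>w. - dd angle y w / 2)"
  proof -
    note a = linear_dd[OF angle_differentiable[OF y]]
    show ?thesis by (intro linearI) (simp_all add: linear_add[OF a] linear_scale[OF a])
  qed
  have "(\<Sum>i\<in>Basis. N i (dual (G y) i) w) = 0"
  proof (rule divergence_zero[OF G_inner_form[OF y] _ P_linear[OF y] c P_skew[OF y] P_P[OF y] _ _ _ _ _ _ dl])
    show "bilinear (N u)" for u using l by (simp add: bilinear_def)
    show "bilinear (\<lambda>u. N u v)" for v using l by (simp add: bilinear_def)
    show "bilinear (\<lambda>u v. N u v x)" for x using l by (simp add: bilinear_def)
    show "N u v x = - N u x v" for u v x by (simp add: N_def)
    \<comment> \<open>Closedness of omega|N, which at this level is the symmetry of
      \<open>sff\<close> in its first two arguments.\<close>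
    show "N u v x + N v x u + N x u v = 0" for u v x
      using sff_sym[of u x v] sff_sym[of u v x] sff_sym[of v x u] by (simp add: N_def)
    show "N w (P y u) u = - dd angle y w / 2 * G y u u" for w u
      using dd_angle[of w u]
      by (simp add: N_def sff_def P_P[OF y] gs[OF y] df_simps[OF y] field_simps)
  qed simp
  then have "(\<Sum>i\<in>Basis. sff y i w (dual (G y) i)) = (\<Sum>i\<in>Basis. sff y i (dual (G y) i) w)"
    by (simp add: N_def sum_subtractf)
  then show ?thesis
    unfolding sff_trace sff_sym[of _ w] .
qed

lemma frame_combination:
  "(\<Sum>j\<in>UNIV. x $ j *s frame y $ j) = dd f y (\<chi> j. Re (x $ j)) + J (dd f y (\<chi> j. Im (x $ j)))"
proof -
  have r: "(\<Sum>j\<in>UNIV. v $ j *\<^sub>R dd f y (axis j 1)) = dd f y v" for v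
  proof -
    have "dd f y v = dd f y (\<Sum>j\<in>UNIV. v $ j *\<^sub>R axis j 1)"
      using real_axis_expansion[of v] by simp
    then show ?thesis by (simp add: linear_sum[OF linear_df[OF y]] df_simps[OF y])
  qed
  show ?thesis
    using r[of "\<chi> j. Re (x $ j)"] r[of "\<chi> j. Im (x $ j)", symmetric]
    by (simp add: frame_def complex_scale_eq sum.distrib linear_sum[OF J_linear] J_simps)
qed

lemma det_frame:
  assumes "angle y < 1"
  shows "det (frame y) \<noteq> 0"
proof -
  have "x = 0" if x: "transpose (frame y) *v x = 0" for x
  proof -
    have "(\<Sum>j\<in>UNIV. x $ j *s frame y $ j) = 0"
      using x by (simp add: vec_eq_iff matrix_vector_mult_def transpose_def mult.commute)
    then have "(\<chi> j. Re (x $ j)) = (0 :: real^4) \<and> (\<chi> j. Im (x $ j)) = (0 :: real^4)"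
      unfolding frame_combination by (rule totally_real[OF y assms])
    then show ?thesis by (simp add: vec_eq_iff complex_eq_iff)
  qed
  then have "invertible (transpose (frame y))"
    using invertible_left_inverse matrix_left_invertible_ker by blast
  then show ?thesis by (simp add: invertible_det_nz)
qed

text \<open>This is where minimality and self-duality enter.\<close>

lemma Im_connection_trace:
  assumes c: "angle y \<noteq> 0" "angle y < 1"
    and C: "\<And>i. hess y w (axis i 1) = (\<Sum>j\<in>UNIV. C $ i $ j *s frame y $ j)"
  shows "Im (trace C) = 0"
proof -
  define b where "b i = (\<chi> j. Im (C $ i $ j))" for i
  \<comment> \<open>The tangent vector \<open>dd f y a\<close> is orthogonal to the normal part of
    \<open>J (dd f y v)\<close>, so \<open>sff\<close> sees only the imaginary coefficients of the
    \<open>i\<close>-th row of \<open>C\<close>.\<close>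
  have s: "sff y w (axis i 1) v = (1 - angle y) * G y (b i) v" for i v
  proof -
    define a where "a = (\<chi> j. Re (C $ i $ j))"
    have h: "hess y w (axis i 1) = dd f y a + J (dd f y (b i))"
      unfolding C frame_combination a_def b_def ..
    have "g (f y) (dd f y a) (J (dd f y v) - dd f y (P y v)) = 0"
      using normal_component(1)[OF y, of v a] gsym[OF y] by metis
    moreover have "g (f y) (J (dd f y (b i))) (J (dd f y v) - dd f y (P y v)) = (1 - angle y) * G y (b i) v"
      using G_P(1)[OF y, of "b i" "P y v"] G_P_P[OF y, of "b i" v]
      by (simp add: gs[OF y] J_invariant[OF image_f[OF y]] W_eq[symmetric] G_eq[symmetric] algebra_simps)
    ultimately show ?thesis
      unfolding sff_def h by (simp add: gs[OF y])
  qed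
  have "0 = (\<Sum>i\<in>UNIV. sff y w (axis i 1) (dual (G y) (axis i 1)))"
    using sff_divergence[OF c(1), of w] by (simp add: sum_Basis_real_vec)
  also have "\<dots> = (1 - angle y) * (\<Sum>i\<in>UNIV. Im (C $ i $ i))"
    by (simp add: s dual[OF G_inner_form[OF y]] inner_axis' b_def sum_distrib_left)
  finally show ?thesis using c(2) by (simp add: trace_def)
qed

end


section \<open>The connection form of the canonical bundle along the submanifold\<close>

lemma det_frame_has_derivative:
  assumes y: "y \<in> U"
  shows "((\<lambda>z. det (frame z)) has_derivative
    (\<lambda>w. \<Sum>k\<in>UNIV. det (\<chi> i. if i = k then dd (\<lambda>z. dd f z (axis i 1)) y w else frame y $ i))) (at y)"
proof -
  let ?F = "\<lambda>w. \<chi> i. dd (\<lambda>z. dd f z (axis i 1)) y w"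
  have "((\<lambda>z. frame z $ i $ j) has_derivative (\<lambda>w. ?F w $ i $ j)) (at y)" for i j
    using bounded_linear.has_derivative[OF bounded_linear_vec_nth dd_works[OF ddf_differentiable[OF y]]]
    by (simp add: frame_def)
  from has_derivative_det[OF this] show ?thesis
    by (rule has_derivative_eq_rhs) (simp add: fun_eq_iff cong: if_cong)
qed

text \<open>The derivative of \<open>frame\<close> is \<open>hess\<close> minus the Christoffel
  term, so Jacobi's formula gives \<open>trace C - trace M\<close> for the logarithmic derivative.
  The first trace is real by \<open>Im_connection_trace\<close>; the second is the complex trace of
  the ambient connection, with imaginary part \<open>- canonical_form / 2\<close>.\<close>

lemma dd_det_frame:
  assumes y: "y \<in> U" and c: "angle y \<noteq> 0" "angle y < 1"
  shows "Im (dd (\<lambda>z. det (frame z)) y w / det (frame y)) = canonical_form (f y) (dd f y w) / 2"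
proof -
  let ?A = "christoffel g (f y) (dd f y w)"
  have fy: "f y \<in> S" by (rule image_f[OF y])
  have det: "det (frame y) \<noteq> 0" by (rule det_frame[OF y c(2)])
  have "\<exists>x. h = (\<Sum>j\<in>UNIV. x $ j *s frame y $ j)" for h
    using row_combination[OF det] by blast
  then obtain x where x: "\<And>h. h = (\<Sum>j\<in>UNIV. x h $ j *s frame y $ j)" by metis
  define C where "C = (\<chi> i. x (hess y w (axis i 1)))"
  define M where "M = (\<chi> i. x (?A (frame y $ i)))"
  have C: "hess y w (axis i 1) = (\<Sum>j\<in>UNIV. C $ i $ j *s frame y $ j)" for i
    using x[of "hess y w (axis i 1)"] by (simp add: C_def)
  have M: "?A (frame y $ i) = (\<Sum>j\<in>UNIV. M $ i $ j *s frame y $ j)" for i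
    using x[of "?A (frame y $ i)"] by (simp add: M_def)
  have "dd (\<lambda>z. dd f z (axis k 1)) y w = (\<Sum>j\<in>UNIV. (C $ k $ j - M $ k $ j) *s frame y $ j)" for k
  proof -
    have "dd (\<lambda>z. dd f z (axis k 1)) y w = hess y w (axis k 1) - ?A (frame y $ k)"
      by (simp add: hess_def frame_def)
    then show ?thesis
      unfolding C M by (simp add: vec_eq_iff left_diff_distrib sum_subtractf)
  qed
  then have "det (\<chi> i. if i = k then dd (\<lambda>z. dd f z (axis i 1)) y w else frame y $ i)
      = (C $ k $ k - M $ k $ k) * det (frame y)" for k
    using det_replace_row[of "dd (\<lambda>z. dd f z (axis k 1)) y w" "\<lambda>j. C $ k $ j - M $ k $ j" "frame y" k]
    by (simp cong: if_cong)
  then have "dd (\<lambda>z. det (frame z)) y w = (trace C - trace M) * det (frame y)"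
    unfolding dd_eqI[OF det_frame_has_derivative[OF y]]
    by (simp add: trace_def sum_subtractf[symmetric] sum_distrib_right)
  then have "dd (\<lambda>z. det (frame z)) y w / det (frame y) = trace C - trace M"
    using det by simp
  moreover have "Im (trace C) = 0" by (rule Im_connection_trace[OF y c C])
  moreover have "trace M = (\<Sum>k\<in>UNIV. ?A (axis k 1) $ k)"
    by (rule trace_conjugate[OF det christoffel_linear_right[OF fy] christoffel_J[OF fy] M])
  moreover have "canonical_form (f y) (dd f y w) = - 2 * Im (\<Sum>k\<in>UNIV. ?A (axis k 1) $ k)"
    unfolding canonical_form_def by (rule trace_J_complex_linear) (rule christoffel_J[OF fy])
  ultimately show ?thesis by simp
qed

lemma canonical_form_pullback:
  assumes y: "y \<in> U"
  shows "((\<lambda>z. canonical_form (f z) (dd f z v)) has_derivative (\<lambda>w.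
      dd (\<lambda>x. canonical_form x (dd f y v)) (f y) (dd f y w)
      + canonical_form (f y) (dd (\<lambda>z. dd f z v) y w))) (at y)"
proof -
  have fU: "f ` U \<subseteq> S" using image_f by blast
  \<comment> \<open>A 1-form is made into a bilinear field by a dummy real factor, later set to the
    constant 1, so that \<open>has_derivative_tensor\<close> applies.\<close>
  have bil: "bilinear (\<lambda>(r::real) u. r * canonical_form x u)" if "x \<in> S" for x
    using canonical_form_linear[OF that]
    by (auto simp: bilinear_def linear_add linear_scale algebra_simps intro!: linearI)
  have d: "(\<lambda>x. r * canonical_form x u) differentiable (at (f y))" for r u
    by (intro differentiable_mult differentiable_const canonical_form_differentiable image_f y)
  from has_derivative_tensor[where h="\<lambda>x r u. r * canonical_form x u" and f=f and y=y,
      OF open_S image_f[OF y] bil d open_U y fU dd_works[OF df_differentiable[OF y]]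
        has_derivative_const[of "1::real"] dd_works[OF ddf_differentiable[OF y]]]
  show ?thesis by simp
qed

text \<open>The left side transforms easily under coordinate changes; through this equivalence the
  zero sets of \<open>angle\<close> in different charts can be compared.\<close>

lemma lagrangian_iff_angle_0:
  assumes y: "y \<in> U"
  shows "(\<forall>u v. W y u v = 0) \<longleftrightarrow> angle y = 0"
proof
  assume "\<forall>u v. W y u v = 0"
  then have "angle y * G y (axis 1 1) (axis 1 1) = 0"
    unfolding G_P_P_diag[OF y, symmetric] by (simp only: G_P(1)[OF y])
  then show "angle y = 0"
    using inner_form_zero_iff[OF G_inner_form[OF y], of "axis 1 1"] by (simp add: axis_eq_0_iff)
qed (simp add: angle_0_lagrangian[OF y])

text \<open>On totally real points with \<open>angle \<noteq> 0\<close> the canonical connection form is exact, so its differential,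
  the Ricci form, vanishes on the submanifold.\<close>

lemma angle_0_or_1:
  assumes ric: "\<And>x u v. x \<in> S \<Longrightarrow> ricci g x u v = k * g x u v" and k: "k \<noteq> 0" and y: "y \<in> U"
  shows "angle y = 0 \<or> angle y = 1"
proof (rule ccontr)
  assume ne: "\<not> (angle y = 0 \<or> angle y = 1)"
  \<comment> \<open>The identity \<open>can\<close> is to be differentiated at \<open>y\<close>, so
    it must hold on a neighbourhood; continuity of \<open>angle\<close> preserves both strict
    inequalities there.\<close>
  define V where "V = {z \<in> U. angle z \<in> {0<..<1}}"
  have "continuous_on U angle"
    by (intro continuous_at_imp_continuous_on ballI differentiable_imp_continuous_within angle_differentiable)
  then have V: "open V"
    unfolding V_def by (rule continuous_open_preimage[OF _ open_U open_greaterThanLessThan, unfolded vimage_def Int_def mem_Collect_eq])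
  have yV: "y \<in> V" using ne angle_bounds[OF y] y by (auto simp: V_def)
  have sub: "z \<in> U" "angle z \<noteq> 0" "angle z < 1" if "z \<in> V" for z
    using that by (auto simp: V_def)
  define D where "D z = det (frame z)" for z
  have can: "Im (dd D z v / D z) = canonical_form (f z) (dd f z v) / 2" if "z \<in> V" for z v
    unfolding D_def by (rule dd_det_frame[OF sub[OF that]])
  have D0: "D z \<noteq> 0" if "z \<in> V" for z
    unfolding D_def by (rule det_frame[OF sub(1,3)[OF that]])
  have Dd: "D differentiable (at z)" if "z \<in> V" for z
    unfolding D_def by (rule differentiableI[OF det_frame_has_derivative[OF sub(1)[OF that]]])
  have ddD: "(\<lambda>z. dd D z v) differentiable (at y)" for v
  proof (rule differentiable_cong_open[OF V yV])
    let ?E = "\<lambda>z k. \<chi> i. if i = k then dd (\<lambda>z. dd f z (axis i 1)) z v else frame z $ i"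
    show "dd D z v = (\<Sum>k\<in>UNIV. det (?E z k))" if "z \<in> V" for z
      unfolding D_def dd_eqI[OF det_frame_has_derivative[OF sub(1)[OF that]]] ..
    have e: "(\<lambda>z. ?E z k $ i $ j) differentiable (at y)" for k i j
    proof -
      have "(\<lambda>z. dd (\<lambda>z. dd f z (axis i 1)) z v) differentiable (at y)"
        by (rule smooth_map_on_differentiable[OF smooth_map_on_dd[OF smooth_map_on_dd[OF smooth_f]] y])
      from differentiableI[OF bounded_linear.has_derivative[OF bounded_linear_vec_nth dd_works[OF this]]]
        differentiableI[OF bounded_linear.has_derivative[OF bounded_linear_vec_nth dd_works[OF ddf_differentiable[OF y]]]]
      show ?thesis by (cases "i = k") (simp_all add: frame_def)
    qed
    have "((\<lambda>z. ?E z k $ i $ j) has_derivative (\<lambda>w. (\<chi> i j. dd (\<lambda>z. ?E z k $ i $ j) y w) $ i $ j)) (at y)" for k i j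
      using dd_works[OF e[where k=k and i=i and j=j]] by simp
    from differentiableI[OF has_derivative_det[OF this]]
    show "(\<lambda>z. \<Sum>k\<in>UNIV. det (?E z k)) differentiable (at y)"
      by (intro differentiable_sum) auto
  qed
  have sym: "dd (\<lambda>z. dd D z v) y w = dd (\<lambda>z. dd D z w) y v" for v w
    by (rule dd_dd_symmetric[OF V yV Dd ddD ddD])
  have "W y w v = 0" for w v
  proof -
    \<comment> \<open>The logarithmic derivative of \<open>D\<close>, used directly so that no
      branch of the logarithm has to be chosen.\<close>
    let ?q = "\<lambda>v z. dd D z v / D z"
    have q: "(?q v has_derivative (\<lambda>w. dd (\<lambda>z. dd D z v) y w / D y - dd D y v * dd D y w / (D y * D y))) (at y)" for v
    proof -
      have "(?q v has_derivative (\<lambda>w. - dd D y v * (inverse (D y) * dd D y w * inverse (D y))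
          + dd (\<lambda>z. dd D z v) y w / D y)) (at y)"
        by (rule has_derivative_divide[OF dd_works[OF ddD] dd_works[OF Dd[OF yV]] D0[OF yV]])
      then show ?thesis
        by (rule has_derivative_eq_rhs) (simp add: fun_eq_iff divide_inverse)
    qed
    have "((\<lambda>z. 2 * Im (?q v z)) has_derivative
        (\<lambda>w. 2 * Im (dd (\<lambda>z. dd D z v) y w / D y - dd D y v * dd D y w / (D y * D y)))) (at y)" for v
      by (intro has_derivative_mult_right bounded_linear.has_derivative[OF bounded_linear_Im] q)
    then have "((\<lambda>z. canonical_form (f z) (dd f z v)) has_derivative
        (\<lambda>w. 2 * Im (dd (\<lambda>z. dd D z v) y w / D y - dd D y v * dd D y w / (D y * D y)))) (at y)" for v
      by (rule has_derivative_transform_within_open[OF _ V yV])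
        (simp add: can)
    from fun_cong[OF has_derivative_unique[OF this canonical_form_pullback[OF y]]]
    have eq: "dd (\<lambda>x. canonical_form x (dd f y v)) (f y) (dd f y w)
        + canonical_form (f y) (dd (\<lambda>z. dd f z v) y w)
        = 2 * Im (dd (\<lambda>z. dd D z v) y w / D y - dd D y v * dd D y w / (D y * D y))" for v w
      by simp
    have "dd (\<lambda>z. dd f z v) y w = dd (\<lambda>z. dd f z w) y v"
      using smooth_map_on_differentiable[OF smooth_f]
      by (intro dd_dd_symmetric[OF open_U y] ddf_differentiable y)
    \<comment> \<open>Antisymmetrise \<open>eq\<close> in \<open>v\<close> and \<open>w\<close>: the
      second derivatives of \<open>D\<close> and \<open>f\<close> and the product of first
      derivatives of \<open>D\<close> are symmetric. What survives is the pulled back exterior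
      derivative of \<open>canonical_form\<close>, a multiple of the Kaehler form.\<close>
    then have "dd (\<lambda>x. canonical_form x (dd f y v)) (f y) (dd f y w)
        - dd (\<lambda>x. canonical_form x (dd f y w)) (f y) (dd f y v) = 0"
      using eq[of v w] eq[of w v] sym[of v w] by (simp add: mult.commute)
    then have "2 * k * kaehler_form g (f y) (dd f y w) (dd f y v) = 0"
      unfolding d_canonical_form[OF image_f[OF y]] einstein_trace[OF image_f[OF y] ric[OF image_f[OF y]]] .
    then show ?thesis using k by (simp add: pullback_def)
  qed
  then show False
    using ne lagrangian_iff_angle_0[OF y] by simp
qed

end

section \<open>Charts\<close>

lemma
  assumes "is_chart X c"
  shows chart_inj: "inj_on (snd c) (fst c)"
    and chart_inv: "p \<in> fst c \<Longrightarrow> inv_into (fst c) (snd c) (snd c p) = p"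
proof -
  have "fst c \<subseteq> topspace X" using assms openin_subset by (auto simp: is_chart_def)
  then have "topspace (subtopology X (fst c)) = fst c" by (simp add: topspace_subtopology Int_absorb1)
  then show inj: "inj_on (snd c) (fst c)"
    using assms homeomorphic_imp_injective_map unfolding is_chart_def by metis
  show "inv_into (fst c) (snd c) (snd c p) = p" if "p \<in> fst c"
    using inv_into_f_f[OF inj that] .
qed

lemma chart_open_image:
  assumes c: "is_chart X c" and T: "openin X T"
  shows "open (snd c ` (fst c \<inter> T))"
proof -
  have "openin (subtopology X (fst c)) (fst c \<inter> T)"
    using T by (simp add: openin_subtopology_Int2)
  moreover have "open_map (subtopology X (fst c)) (top_of_set (chart_image c)) (snd c)"
    using c homeomorphic_imp_open_map unfolding is_chart_def by blast
  ultimately have "openin (top_of_set (chart_image c)) (snd c ` (fst c \<inter> T))"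
    unfolding open_map_def by blast
  then show ?thesis
    using c openin_open_trans unfolding is_chart_def by blast
qed

lemma chart_open_preimage:
  assumes c: "is_chart X c" and T: "open T"
  shows "openin X {p \<in> fst c. snd c p \<in> T}"
proof -
  have sub: "fst c \<subseteq> topspace X" using c openin_subset by (auto simp: is_chart_def)
  have "continuous_map (subtopology X (fst c)) (top_of_set (chart_image c)) (snd c)"
    using c homeomorphic_imp_continuous_map unfolding is_chart_def by blast
  then have "continuous_map (subtopology X (fst c)) euclidean (snd c)"
    by (simp add: continuous_map_in_subtopology)
  moreover have top: "topspace (subtopology X (fst c)) = fst c"
    using sub by (simp add: topspace_subtopology Int_absorb1)
  moreover have "openin euclidean T" using T by simp
  ultimately have "openin (subtopology X (fst c)) {p \<in> fst c. snd c p \<in> T}"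
    using openin_continuous_map_preimage by fastforce
  moreover have "openin X (fst c)" using c by (simp add: is_chart_def)
  ultimately show ?thesis
    using openin_open_subtopology by blast
qed

lemma coord_change_chart:
  "is_chart X c \<Longrightarrow> p \<in> fst c \<Longrightarrow> coord_change c d (snd c p) = snd d p"
  by (simp add: coord_change_def chart_inv)

section \<open>From charts to the whole submanifold\<close>

locale kaehler_submanifold =
  fixes M :: "'p topology" and A :: "('p, complex^4) chart set"
    and g :: "('p, complex^4) chart \<Rightarrow> (complex^4) tensor2"
    and N :: "'p topology" and B :: "('p, real^4) chart set"
  assumes kaehler: "kaehler_manifold M A g" and sub: "submanifold N B M A"
    and min: "minimal_submanifold B A g" and cay: "cayley_submanifold B A g"
begin

lemma
  shows chart_A: "d \<in> A \<Longrightarrow> is_chart M d" and chart_B: "c \<in> B \<Longrightarrow> is_chart N c"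
    and charts_A: "(\<Union>d\<in>A. fst d) = topspace M" and charts_B: "(\<Union>c\<in>B. fst c) = topspace N"
    and smooth_A: "d \<in> A \<Longrightarrow> d' \<in> A \<Longrightarrow> smooth_map_on (overlap d d') (coord_change d d')"
    and smooth_B: "c \<in> B \<Longrightarrow> c' \<in> B \<Longrightarrow> smooth_map_on (overlap c c') (coord_change c c')"
  using kaehler sub
  by (simp_all add: kaehler_manifold_def complex_manifold_def smooth_manifold_def submanifold_def)

text \<open>Continuity of the inclusion gives this, also when the topology of \<open>N\<close> is
  finer than the subspace topology.\<close>

lemma open_in_N: "d \<in> A \<Longrightarrow> openin N {p \<in> topspace N. p \<in> fst d}"
  using sub chart_A[of d] openin_continuous_map_preimage[of N M id "fst d"]
  by (simp add: submanifold_def is_chart_def)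

lemma overlap_eq: "c \<in> B \<Longrightarrow> overlap c d = snd c ` (fst c \<inter> {p \<in> topspace N. p \<in> fst d})"
  using charts_B by (auto simp: overlap_def)

lemma immersion:
  assumes c: "c \<in> B" and d: "d \<in> A"
  shows "kaehler_immersion (chart_image d) (g d) (overlap c d) (coord_change c d)"
proof unfold_locales
  note K = kaehler[unfolded kaehler_manifold_def riemannian_metric_def]
  show "open (chart_image d)" using chart_A[OF d] by (simp add: is_chart_def)
  show "inner_form (g d x)" if "x \<in> chart_image d" for x using K d that by simp
  show "smooth_map_on (chart_image d) (\<lambda>x. g d x u v)" for u v using K d by simp
  show "g d x (J u) (J v) = g d x u v" if "x \<in> chart_image d" for x u v using K d that by simp
  show "closed_two_form (chart_image d) (kaehler_form (g d))" using K d by simp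
  show "open (overlap c d)"
    unfolding overlap_eq[OF c] by (rule chart_open_image[OF chart_B[OF c] open_in_N[OF d]])
  show "coord_change c d y \<in> chart_image d" if "y \<in> overlap c d" for y
  proof -
    from that obtain p where "y = snd c p" "p \<in> fst c" "p \<in> fst d" unfolding overlap_def by blast
    then show ?thesis
      using coord_change_chart[OF chart_B[OF c], of p d] by (simp add: chart_image_def)
  qed
  show "smooth_map_on (overlap c d) (coord_change c d)" using sub c d by (simp add: submanifold_def)
  show "inj (dd (coord_change c d) y)" if "y \<in> overlap c d" for y
    using sub c d that by (simp add: submanifold_def)
  show "mean_curvature (g d) (coord_change c d) y = 0" if "y \<in> overlap c d" for y
    using min c d that by (simp add: minimal_submanifold_def)
  show "pullback (coord_change c d) (kaehler_form (g d)) y = hodge_star (pullback (coord_change c d) (g d) y)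
      (pullback (coord_change c d) (kaehler_form (g d)) y)" if "y \<in> overlap c d" for y
    using cay c d that unfolding cayley_submanifold_def by blast
qed

definition kaehler_angle :: "('p, real^4) chart \<Rightarrow> ('p, complex^4) chart \<Rightarrow> real^4 \<Rightarrow> real"
  where "kaehler_angle c d = kaehler_immersion.angle (g d) (coord_change c d)"

lemma overlapI: "p \<in> fst c \<Longrightarrow> p \<in> fst d \<Longrightarrow> snd c p \<in> overlap c d"
  by (auto simp: overlap_def)

text \<open>Near \<open>p\<close> the inclusion is \<open>?t\<close> after \<open>?f'\<close> after
  \<open>?s\<close>; the ambient change \<open>?t\<close> has complex linear derivative and
  preserves the metric, hence the Kaehler form. Transporting just this vanishing avoids any
  transformation law for \<open>hodge_star\<close>.\<close>

lemma lagrangian_chart_independent: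
  assumes c: "c \<in> B" "c' \<in> B" and d: "d \<in> A" "d' \<in> A"
    and p: "p \<in> fst c" "p \<in> fst c'" "p \<in> fst d" "p \<in> fst d'"
    and lag: "\<And>u v. pullback (coord_change c' d') (kaehler_form (g d')) (snd c' p) u v = 0"
  shows "pullback (coord_change c d) (kaehler_form (g d)) (snd c p) u v = 0"
proof -
  let ?f = "coord_change c d" and ?f' = "coord_change c' d'"
  let ?s = "coord_change c c'" and ?t = "coord_change d' d"
  let ?y = "snd c p"
  let ?T = "fst c' \<inter> {p \<in> topspace N. p \<in> fst d} \<inter> {p \<in> topspace N. p \<in> fst d'}"
  have O: "open (snd c ` (fst c \<inter> ?T))"
  proof (rule chart_open_image[OF chart_B[OF c(1)]])
    have "openin N (fst c')" using chart_B[OF c(2)] by (simp add: is_chart_def)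
    then show "openin N ?T" by (intro openin_Int open_in_N d)
  qed
  have y: "?y \<in> snd c ` (fst c \<inter> ?T)" using p charts_B c(1) by auto
  have eq: "?f z = ?t (?f' (?s z))" if "z \<in> snd c ` (fst c \<inter> ?T)" for z
  proof -
    from that obtain q where q: "z = snd c q" "q \<in> fst c" "q \<in> fst c'" "q \<in> fst d'" by blast
    then show ?thesis
      by (simp only: coord_change_chart[OF chart_B[OF c(1)]] coord_change_chart[OF chart_B[OF c(2)]]
          coord_change_chart[OF chart_A[OF d(2)]])
  qed
  have s: "?s ?y = snd c' p" and f': "?f' (snd c' p) = snd d' p" and f: "?f ?y = snd d p"
    and t: "?t (snd d' p) = snd d p"
    by (rule coord_change_chart[OF chart_B[OF c(1)] p(1)] coord_change_chart[OF chart_B[OF c(2)] p(2)]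
      coord_change_chart[OF chart_A[OF d(2)] p(4)])+
  have ds: "?s differentiable (at ?y)"
    by (rule smooth_map_on_differentiable[OF smooth_B[OF c] overlapI[OF p(1,2)]])
  have df': "?f' differentiable (at (snd c' p))"
    by (rule smooth_map_on_differentiable[OF kaehler_immersion.smooth_f[OF immersion[OF c(2) d(2)]]
        overlapI[OF p(2,4)]])
  have dt: "?t differentiable (at (snd d' p))"
    by (rule smooth_map_on_differentiable[OF smooth_A[OF d(2,1)] overlapI[OF p(4,3)]])
  have "((\<lambda>z. ?t (?f' (?s z))) has_derivative (\<lambda>w. dd ?t (snd d' p) (dd ?f' (snd c' p) (dd ?s ?y w)))) (at ?y)"
  proof (rule has_derivative_compose[OF dd_works[OF ds]])
    have "(?t has_derivative dd ?t (snd d' p)) (at (?f' (snd c' p)))"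
      unfolding f' by (rule dd_works[OF dt])
    then show "((\<lambda>z. ?t (?f' z)) has_derivative (\<lambda>w. dd ?t (snd d' p) (dd ?f' (snd c' p) w))) (at (?s ?y))"
      unfolding s by (rule has_derivative_compose[OF dd_works[OF df']])
  qed
  then have "dd (\<lambda>z. ?t (?f' (?s z))) ?y = (\<lambda>w. dd ?t (snd d' p) (dd ?f' (snd c' p) (dd ?s ?y w)))"
    by (rule dd_eqI)
  moreover have "dd ?f ?y = dd (\<lambda>z. ?t (?f' (?s z))) ?y"
    by (rule dd_cong_open[OF O y]) (rule eq)
  ultimately have df: "dd ?f ?y = (\<lambda>w. dd ?t (snd d' p) (dd ?f' (snd c' p) (dd ?s ?y w)))"
    by simp
  have x: "snd d' p \<in> overlap d' d" by (rule overlapI[OF p(4,3)])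
  have J: "dd ?t (snd d' p) (J w) = J (dd ?t (snd d' p) w)" for w
    using kaehler d x by (simp add: kaehler_manifold_def complex_manifold_def)
  have gd: "g d' (snd d' p) = pullback ?t (g d) (snd d' p)"
    using kaehler d x unfolding kaehler_manifold_def riemannian_metric_def by blast
  have "pullback ?f (kaehler_form (g d)) ?y u v =
      pullback ?f' (kaehler_form (g d')) (snd c' p) (dd ?s ?y u) (dd ?s ?y v)"
    by (simp add: pullback_def kaehler_form_def df f f' t gd J)
  then show ?thesis using lag by simp
qed

lemma complex_or_lagrangian:
  assumes ric: "\<And>d x u v. d \<in> A \<Longrightarrow> x \<in> chart_image d \<Longrightarrow> ricci (g d) x u v = k * g d x u v"
    and k: "k \<noteq> 0" and conn: "connected_space N"
  shows "complex_submanifold B A \<or> lagrangian_submanifold B A g"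
proof -
  have cases: "kaehler_angle c d y = 0 \<or> kaehler_angle c d y = 1"
    if "c \<in> B" "d \<in> A" "y \<in> overlap c d" for c d y
    unfolding kaehler_angle_def
    by (rule kaehler_immersion.angle_0_or_1[OF immersion[OF that(1,2)] ric[OF that(2)] k that(3)])
  \<comment> \<open>For \<open>a\<close> equal to 0 or 1, an angle with values in these two numbers
    and at distance below 1 from \<open>a\<close> equals \<open>a\<close>. The window thus cuts out
    a level set while making it visibly open.\<close>
  define E where "E a = (\<Union>c\<in>B. \<Union>d\<in>A. {p \<in> fst c. snd c p \<in> {y \<in> overlap c d. \<bar>kaehler_angle c d y - a\<bar> < 1}})" for a :: real
  have E: "p \<in> E a \<longleftrightarrow> (\<exists>c\<in>B. \<exists>d\<in>A. p \<in> fst c \<and> p \<in> fst d \<and> kaehler_angle c d (snd c p) = a)"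
    if a: "a = 0 \<or> a = 1" for p a
  proof
    assume "p \<in> E a"
    then obtain c d where cd: "c \<in> B" "d \<in> A" "p \<in> fst c" "snd c p \<in> overlap c d"
      "\<bar>kaehler_angle c d (snd c p) - a\<bar> < 1" by (auto simp: E_def)
    then have "p \<in> fst d"
      using inj_onD[OF chart_inj[OF chart_B[OF cd(1)]]] by (auto simp: overlap_def)
    moreover have "kaehler_angle c d (snd c p) = a" using cases[OF cd(1,2,4)] cd(5) a by auto
    ultimately show "\<exists>c\<in>B. \<exists>d\<in>A. p \<in> fst c \<and> p \<in> fst d \<and> kaehler_angle c d (snd c p) = a"
      using cd by blast
  next
    assume "\<exists>c\<in>B. \<exists>d\<in>A. p \<in> fst c \<and> p \<in> fst d \<and> kaehler_angle c d (snd c p) = a"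
    then obtain c d where cd: "c \<in> B" "d \<in> A" "p \<in> fst c" "p \<in> fst d" "kaehler_angle c d (snd c p) = a"
      by blast
    then have "p \<in> {p \<in> fst c. snd c p \<in> {y \<in> overlap c d. \<bar>kaehler_angle c d y - a\<bar> < 1}}"
      using overlapI[OF cd(3,4)] by simp
    then show "p \<in> E a" unfolding E_def using cd(1,2) by blast
  qed
  have open_E: "openin N (E a)" for a
  proof -
    have "openin N {p \<in> fst c. snd c p \<in> {y \<in> overlap c d. \<bar>kaehler_angle c d y - a\<bar> < 1}}"
      if c: "c \<in> B" and d: "d \<in> A" for c d
    proof -
    interpret kaehler_immersion "chart_image d" "g d" "overlap c d" "coord_change c d"
      by (rule immersion[OF c d])
    have "continuous_on (overlap c d) (kaehler_angle c d)"
      unfolding kaehler_angle_def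
      by (intro continuous_at_imp_continuous_on ballI differentiable_imp_continuous_within angle_differentiable)
    then have "continuous_on (overlap c d) (\<lambda>y. \<bar>kaehler_angle c d y - a\<bar>)"
      by (intro continuous_intros)
    from continuous_open_preimage[OF this open_U, of "{..<1}"]
    have "open {y \<in> overlap c d. \<bar>kaehler_angle c d y - a\<bar> < 1}"
      by (simp add: vimage_def Int_def)
    then show ?thesis
      by (rule chart_open_preimage[OF chart_B[OF c]])
    qed
    then show ?thesis unfolding E_def by (intro openin_Union) auto
  qed
  have "topspace N \<subseteq> E 0 \<union> E 1"
  proof
    fix p assume p: "p \<in> topspace N"
    then obtain c d where cd: "c \<in> B" "d \<in> A" "p \<in> fst c" "p \<in> fst d"
      using charts_B charts_A sub unfolding submanifold_def by blast
    then show "p \<in> E 0 \<union> E 1"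
      using cases[OF cd(1,2) overlapI[OF cd(3,4)]] E[of 0 p] E[of 1 p] by blast
  qed
  \<comment> \<open>Membership in the two sets may be witnessed by different charts, so the
    vanishing of omega|N is carried from one pair to the other.\<close>
  moreover have "E 0 \<inter> E 1 = {}"
  proof (rule equals0I)
    fix p assume p: "p \<in> E 0 \<inter> E 1"
    then obtain c d where cd: "c \<in> B" "d \<in> A" "p \<in> fst c" "p \<in> fst d" "kaehler_angle c d (snd c p) = 0"
      using E[of 0 p] by auto
    from p obtain c' d' where cd': "c' \<in> B" "d' \<in> A" "p \<in> fst c'" "p \<in> fst d'" "kaehler_angle c' d' (snd c' p) = 1"
      using E[of 1 p] by auto
    have "pullback (coord_change c d) (kaehler_form (g d)) (snd c p) u v = 0" for u v
      using kaehler_immersion.angle_0_lagrangian[OF immersion[OF cd(1,2)] overlapI[OF cd(3,4)]] cd(5)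
      by (simp add: kaehler_angle_def)
    then have "pullback (coord_change c' d') (kaehler_form (g d')) (snd c' p) u v = 0" for u v
      by (rule lagrangian_chart_independent[OF cd'(1) cd(1) cd'(2) cd(2) cd'(3) cd(3) cd'(4) cd(4)])
    then have "kaehler_angle c' d' (snd c' p) = 0"
      unfolding kaehler_angle_def
      using kaehler_immersion.lagrangian_iff_angle_0[OF immersion[OF cd'(1,2)] overlapI[OF cd'(3,4)]] by blast
    then show False using cd'(5) by simp
  qed
  ultimately have "E 0 = {} \<or> E 1 = {}"
    using conn open_E unfolding connected_space_def by blast
  then show ?thesis
  proof
    assume E0: "E 0 = {}"
    have "complex_submanifold B A"
      unfolding complex_submanifold_def
    proof (intro ballI)
      fix c d y assume cd: "c \<in> B" "d \<in> A" "y \<in> overlap c d"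
      then obtain p where p: "p \<in> fst c" "p \<in> fst d" "y = snd c p" by (auto simp: overlap_def)
      have "kaehler_angle c d y \<noteq> 0" using E[of 0 p] E0 cd p by blast
      then have "kaehler_immersion.angle (g d) (coord_change c d) y = 1"
        using cases[OF cd] by (simp add: kaehler_angle_def)
      then show "J ` range (dd (coord_change c d) y) = range (dd (coord_change c d) y)"
        by (rule kaehler_immersion.angle_1_complex[OF immersion[OF cd(1,2)] cd(3)])
    qed
    then show ?thesis ..
  next
    assume E1: "E 1 = {}"
    have "lagrangian_submanifold B A g"
      unfolding lagrangian_submanifold_def
    proof (intro ballI allI)
      fix c d y u v assume cd: "c \<in> B" "d \<in> A" "y \<in> overlap c d"
      then obtain p where p: "p \<in> fst c" "p \<in> fst d" "y = snd c p" by (auto simp: overlap_def)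
      have "kaehler_angle c d y \<noteq> 1" using E[of 1 p] E1 cd p by blast
      then have "kaehler_immersion.angle (g d) (coord_change c d) y = 0"
        using cases[OF cd] by (simp add: kaehler_angle_def)
      then show "pullback (coord_change c d) (kaehler_form (g d)) y u v = 0"
        by (rule kaehler_immersion.angle_0_lagrangian[OF immersion[OF cd(1,2)] cd(3)])
    qed
    then show ?thesis ..
  qed
qed

end

theorem theorem2:
  fixes M :: "'p topology" and A :: "('p, complex^4) chart set"
    and g :: "('p, complex^4) chart \<Rightarrow> (complex^4) tensor2"
    and N :: "'p topology" and B :: "('p, real^4) chart set"
  assumes "kaehler_einstein M A g"
    and "\<forall>c\<in>A. \<forall>x\<in>chart_image c. scalar_curv (g c) x \<noteq> 0"
    and "submanifold N B M A"
    and "connected_space N"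
    and "minimal_submanifold B A g"
    and "cayley_submanifold B A g"
  shows "complex_submanifold B A \<or> lagrangian_submanifold B A g"
proof -
  interpret kaehler_submanifold M A g N B
    using assms by unfold_locales (auto simp: kaehler_einstein_def)
  obtain k where k: "\<And>d x u v. d \<in> A \<Longrightarrow> x \<in> chart_image d \<Longrightarrow>
      ricci_form (g d) x u v = k * kaehler_form (g d) x u v"
    using assms(1) unfolding kaehler_einstein_def by blast
  \<comment> \<open>Since \<open>J (- J u) = u\<close>, inserting \<open>- J u\<close> turns the
    condition on the forms into one on the symmetric tensors.\<close>
  have ric: "ricci (g d) x u v = k * g d x u v" if "d \<in> A" "x \<in> chart_image d" for d x u v
    using k[OF that, of "- J u" v] by (simp add: ricci_form_def kaehler_form_def J_simps)
  show ?thesis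
  \<comment> \<open>A point is required to deduce \<open>k \<noteq> 0\<close> from the scalar
    curvature. Without overlaps \<open>N\<close> is empty and the first alternative holds
    vacuously.\<close>
  proof (cases "\<exists>c\<in>B. \<exists>d\<in>A. overlap c d \<noteq> {}")
    case True
    then obtain d x where dx: "d \<in> A" "x \<in> chart_image d"
      by (auto simp: overlap_def chart_image_def)
    have "k \<noteq> 0"
    proof
      assume "k = 0"
      then have "scalar_curv (g d) x = 0"
        by (simp add: scalar_curv_def metric_trace_def ric[OF dx])
      then show False using assms(2) dx by blast
    qed
    then show ?thesis using complex_or_lagrangian ric assms(4) by blast
  next
    case False
    then show ?thesis by (auto simp: complex_submanifold_def)
  qed
qed

end
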